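(* Let $(F,d)$ be an ordinary differential field of characteristic zero with constant field $C\neq F$, let $n>1$, and let $H$ be a subgroup of $GL(n,C)\propto C^n$. Let $z_i=(z_{1i},\dots,z_{ni})$, $i=1,\dots,n+1$, be column vectors of independent indeterminates over $C$, and let $H$ act by $((h,h_0),(z_1,z_2,\dots,z_{n+1}))\mapsto(hz_1+h_0,hz_2,\dots,hz_{n+1})$. If $\varphi_1(z_1,\dots,z_{n+1}),\dots,\varphi_k(z_1,\dots,z_{n+1})$ is any system of generators of the field $C(z_1,\dots,z_{n+1})^H$ over $C$, then the system $$\frac{W^d_1\{dx,d^{n+1}x\}}{W^d\{dx\}},\dots,\frac{W^d_n\{dx,d^{n+1}x\}}{W^d\{dx\}},\ \varphi_1(x,dx,\dots,d^nx),\dots,\varphi_k(x,dx,\dots,d^nx)$$ is a system of generators of the $d$-differential field $(C\langle x,d\rangle^H,d)$ over $C$.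
   Context: $x$ is the column vector of $x_1,\dots,x_n$, which are $d$-differentially algebraically independent over $F$. $C\langle x,d\rangle$ is the field of differential rational functions in $x_1,\dots,x_n$ over $C$, i.e. the field of fractions of $C[x,dx,d^2x,\dots]$. $GL(n,C)\propto C^n$ is the affine group, $(h,h_0)$ acting by $x\mapsto hx+h_0$; $C\langle x,d\rangle^H$ is the field of all $f^d\langle x\rangle\in C\langle x,d\rangle$ with $f^d\langle hx+h_0\rangle=f^d\langle x\rangle$ for all $(h,h_0)\in H$; it is closed under $d$. $C(z_1,\dots,z_{n+1})^H$ is the field of rational functions over $C$ in all $z_{ji}$ invariant under the stated action of $H$. $W^d\{dx\}=\det[dx,d^2x,\dots,d^nx]$, and $W^d_i\{dx,d^{n+1}x\}$ is the determinant of the matrix obtained from $[dx,d^2x,\dots,d^nx,d^{n+1}x]$ by deleting the column $d^ix$, $i=1,\dots,n$. *)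

theory Defs
  imports
    "HOL-Library.Poly_Mapping"
    "HOL-Library.Product_Lexorder"
    "HOL-Computational_Algebra.Fraction_Field"
    "Jordan_Normal_Form.Determinant"
begin

section \<open>Subfields, derivations, differential subfields\<close>

definition is_subfield :: "'a::field set \<Rightarrow> bool" where
  "is_subfield L \<longleftrightarrow> 0 \<in> L \<and> 1 \<in> L \<and>
     (\<forall>a\<in>L. \<forall>b\<in>L. a + b \<in> L \<and> a - b \<in> L \<and> a * b \<in> L) \<and> (\<forall>a\<in>L. inverse a \<in> L)"

definition derivation :: "('a::field \<Rightarrow> 'a) \<Rightarrow> bool" where
  "derivation d \<longleftrightarrow> (\<forall>a b. d (a + b) = d a + d b) \<and> (\<forall>a b. d (a * b) = d a * b + a * d b)"

definition is_diff_subfield :: "('a::field \<Rightarrow> 'a) \<Rightarrow> 'a set \<Rightarrow> bool" where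
  "is_diff_subfield d L \<longleftrightarrow> is_subfield L \<and> (\<forall>a\<in>L. d a \<in> L)"

definition const_field :: "('a::field \<Rightarrow> 'a) \<Rightarrow> 'a set \<Rightarrow> 'a set" where
  "const_field d F = {c \<in> F. d c = 0}"

section \<open>Polynomials and rational functions in indeterminates indexed by pairs\<close>

text \<open>The indeterminate \<open>(j, m)\<close> plays two roles: it is the \<open>j\<close>-th entry of the column of
  indeterminates \<open>z\<^sub>m\<^sub>+\<^sub>1\<close> (columns are numbered from 0 here), and it is the symbol for the \<open>m\<close>-th derivative
  of the \<open>j\<close>-th entry of the column of differential indeterminates. Rows are numbered from 0 as well.\<close>

type_synonym 'a mpoly = "((nat \<times> nat) \<Rightarrow>\<^sub>0 nat) \<Rightarrow>\<^sub>0 'a"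
type_synonym 'a mrat = "'a mpoly fract"

definition mpolys :: "'a::zero set \<Rightarrow> (nat \<times> nat) set \<Rightarrow> 'a mpoly set" where
  "mpolys C V = {p. range (Poly_Mapping.lookup p) \<subseteq> C \<and> (\<forall>m \<in> Poly_Mapping.keys p. Poly_Mapping.keys m \<subseteq> V)}"

definition mrats :: "'a::idom set \<Rightarrow> (nat \<times> nat) set \<Rightarrow> 'a mrat set" where
  "mrats C V = {Fract p q | p q. p \<in> mpolys C V \<and> q \<in> mpolys C V \<and> q \<noteq> 0}"

definition rconst :: "'a::idom \<Rightarrow> 'a mrat" where
  "rconst c = Fract (Poly_Mapping.single 0 c) 1"

definition rvar :: "nat \<times> nat \<Rightarrow> 'a::idom mrat" where
  "rvar v = Fract (Poly_Mapping.single (Poly_Mapping.single v 1) 1) 1"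

text \<open>In the evaluation maps, \<open>\<iota>\<close> embeds the coefficients into the target field. A rational function
  is evaluated through any representation whose denominator does not vanish at the given point; the
  value does not depend on it, see \<open>mrat_eval_Fract\<close>.\<close>

definition mpoly_eval :: "('a::zero \<Rightarrow> 'b::comm_ring_1) \<Rightarrow> (nat \<times> nat \<Rightarrow> 'b) \<Rightarrow> 'a mpoly \<Rightarrow> 'b" where
  "mpoly_eval \<iota> a p =
     (\<Sum>m \<in> Poly_Mapping.keys p. \<iota> (Poly_Mapping.lookup p m) * (\<Prod>v \<in> Poly_Mapping.keys m. a v ^ Poly_Mapping.lookup m v))"

definition mrat_eval :: "('a::idom \<Rightarrow> 'b::field) \<Rightarrow> (nat \<times> nat \<Rightarrow> 'b) \<Rightarrow> 'a mrat \<Rightarrow> 'b" where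
  "mrat_eval \<iota> a f =
     (THE y. \<exists>p q. f = Fract p q \<and> mpoly_eval \<iota> a q \<noteq> 0 \<and> y = mpoly_eval \<iota> a p / mpoly_eval \<iota> a q)"

section \<open>The affine group\<close>

definition affine_group :: "nat \<Rightarrow> 'a::field set \<Rightarrow> ('a mat \<times> 'a vec) monoid" where
  "affine_group n C =
    \<lparr> carrier = {(h, h0). h \<in> carrier_mat n n \<and> h0 \<in> carrier_vec n \<and>
        (\<forall>i<n. \<forall>j<n. h $$ (i, j) \<in> C) \<and> (\<forall>i<n. h0 $ i \<in> C) \<and> det h \<noteq> 0},
      mult = (\<lambda>(g, g0) (h, h0). (g * h, g *\<^sub>v h0 + g0)),
      one = (1\<^sub>m n, 0\<^sub>v n) \<rparr>"

section \<open>Invariant rational functions of \<open>n + 1\<close> columns\<close>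

definition zcol :: "nat \<Rightarrow> nat \<Rightarrow> 'a::idom mrat vec" where
  "zcol n m = vec n (\<lambda>j. rvar (j, m))"

text \<open>The image of \<open>z\<^sub>m\<^sub>+\<^sub>1\<close>; only the first column is translated.\<close>

definition zcol_act :: "nat \<Rightarrow> 'a::field mat \<times> 'a vec \<Rightarrow> nat \<Rightarrow> 'a mrat vec" where
  "zcol_act n = (\<lambda>(h, h0) m.
     map_mat rconst h *\<^sub>v zcol n m + (if m = 0 then map_vec rconst h0 else 0\<^sub>v n))"

definition inv_mrats :: "nat \<Rightarrow> 'a::field set \<Rightarrow> ('a mat \<times> 'a vec) set \<Rightarrow> 'a mrat set" where
  "inv_mrats n C H = {f \<in> mrats C ({..<n} \<times> {..n}).
     \<forall>g\<in>H. mrat_eval rconst (\<lambda>(j, m). zcol_act n g m $ j) f = f}"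

section \<open>Differential rational functions\<close>

definition jet :: "('a \<Rightarrow> 'a) \<Rightarrow> 'a vec \<Rightarrow> nat \<times> nat \<Rightarrow> 'a" where
  "jet d x = (\<lambda>(j, m). (d ^^ m) (x $ j))"

definition diff_alg_indep :: "('a::field \<Rightarrow> 'a) \<Rightarrow> 'a set \<Rightarrow> nat \<Rightarrow> 'a vec \<Rightarrow> bool" where
  "diff_alg_indep d F n x \<longleftrightarrow>
     (\<forall>p \<in> mpolys F ({..<n} \<times> UNIV). mpoly_eval (\<lambda>c. c) (jet d x) p = 0 \<longrightarrow> p = 0)"

abbreviation diff_rat_eval :: "('a::field \<Rightarrow> 'a) \<Rightarrow> 'a mrat \<Rightarrow> 'a vec \<Rightarrow> 'a" where
  "diff_rat_eval d f x \<equiv> mrat_eval (\<lambda>c. c) (jet d x) f"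

definition inv_diff_field ::
    "('a::field \<Rightarrow> 'a) \<Rightarrow> 'a set \<Rightarrow> nat \<Rightarrow> 'a vec \<Rightarrow> ('a mat \<times> 'a vec) set \<Rightarrow> 'a set" where
  "inv_diff_field d C n x H = {diff_rat_eval d f x | f. f \<in> mrats C ({..<n} \<times> UNIV) \<and>
     (\<forall>(h, h0)\<in>H. diff_rat_eval d f (h *\<^sub>v x + h0) = diff_rat_eval d f x)}"

section \<open>The Wronskian determinants\<close>

definition wronskian :: "('a::field \<Rightarrow> 'a) \<Rightarrow> nat \<Rightarrow> 'a vec \<Rightarrow> 'a" where
  "wronskian d n x = det (mat_of_cols n [map_vec (d ^^ m) x. m \<leftarrow> [1..<n+1]])"

definition wronskian_del :: "('a::field \<Rightarrow> 'a) \<Rightarrow> nat \<Rightarrow> nat \<Rightarrow> 'a vec \<Rightarrow> 'a" where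
  "wronskian_del d n i x = det (mat_of_cols n [map_vec (d ^^ m) x. m \<leftarrow> [1..<n+2], m \<noteq> i])"

section \<open>Evaluation is independent of the representation\<close>

lemma mpoly_eval_superset:
  assumes "\<iota> 0 = 0" "finite S" "Poly_Mapping.keys p \<subseteq> S"
  shows "mpoly_eval \<iota> a p =
    (\<Sum>m\<in>S. \<iota> (Poly_Mapping.lookup p m) * (\<Prod>v \<in> Poly_Mapping.keys m. a v ^ Poly_Mapping.lookup m v))"
  unfolding mpoly_eval_def using assms
  by (intro sum.mono_neutral_left) (auto simp: in_keys_iff)

lemma monom_eval_add:
  fixes a :: "'v \<Rightarrow> 'b::comm_ring_1"
  shows "(\<Prod>v \<in> Poly_Mapping.keys (m + m'). a v ^ Poly_Mapping.lookup (m + m') v) =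
    (\<Prod>v \<in> Poly_Mapping.keys m. a v ^ Poly_Mapping.lookup m v) *
    (\<Prod>v \<in> Poly_Mapping.keys m'. a v ^ Poly_Mapping.lookup m' v)"
proof -
  let ?S = "Poly_Mapping.keys m \<union> Poly_Mapping.keys m'"
  have *: "(\<Prod>v \<in> Poly_Mapping.keys l. a v ^ Poly_Mapping.lookup l v) =
      (\<Prod>v \<in> ?S. a v ^ Poly_Mapping.lookup l v)" if "Poly_Mapping.keys l \<subseteq> ?S" for l
    using that by (intro prod.mono_neutral_left) (auto simp: in_keys_iff)
  show ?thesis
    using *[OF keys_add] *[of m] *[of m'] by (simp add: lookup_add power_add prod.distrib)
qed

lemma mpoly_eval_add:
  assumes "comm_ring_hom \<iota>"
  shows "mpoly_eval \<iota> a (p + q) = mpoly_eval \<iota> a p + mpoly_eval \<iota> a q"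
proof -
  interpret comm_ring_hom \<iota> by fact
  let ?S = "Poly_Mapping.keys p \<union> Poly_Mapping.keys q"
  note * = mpoly_eval_superset[where \<iota> = \<iota> and a = a and S = ?S, OF hom_zero]
  have "mpoly_eval \<iota> a (p + q) = (\<Sum>m\<in>?S. \<iota> (Poly_Mapping.lookup (p + q) m) *
      (\<Prod>v \<in> Poly_Mapping.keys m. a v ^ Poly_Mapping.lookup m v))"
    by (rule *) (simp_all add: keys_add)
  also have "\<dots> = mpoly_eval \<iota> a p + mpoly_eval \<iota> a q"
    by (subst *[of p], simp, simp, subst *[of q], simp, simp)
      (simp add: lookup_add hom_add distrib_right sum.distrib)
  finally show ?thesis .
qed

lemma mpoly_eval_single:
  assumes "comm_ring_hom \<iota>"
  shows "mpoly_eval \<iota> a (Poly_Mapping.single m c) =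
    \<iota> c * (\<Prod>v \<in> Poly_Mapping.keys m. a v ^ Poly_Mapping.lookup m v)"
proof -
  interpret comm_ring_hom \<iota> by fact
  show ?thesis by (subst mpoly_eval_superset[where S = "{m}"]) auto
qed

lemma mpoly_induct [case_names zero add]:
  fixes p :: "'a \<Rightarrow>\<^sub>0 'b::monoid_add"
  assumes "P 0" "\<And>p m c. P p \<Longrightarrow> P (Poly_Mapping.single m c + p)"
  shows "P p"
proof (induction p rule: update_induct)
  case (update f m c)
  have "Poly_Mapping.update m c f = Poly_Mapping.single m c + f"
    by (rule poly_mapping_eqI)
      (use update in \<open>auto simp: Poly_Mapping.lookup_update lookup_add lookup_single in_keys_iff when_def\<close>)
  with assms(2) update show ?case by metis
qed (use assms in auto)

lemma mpoly_eval_mult: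
  assumes "comm_ring_hom \<iota>"
  shows "mpoly_eval \<iota> a (p * q) = mpoly_eval \<iota> a p * mpoly_eval \<iota> a q"
proof -
  interpret comm_ring_hom \<iota> by fact
  have 0: "mpoly_eval \<iota> a 0 = 0" by (simp add: mpoly_eval_def)
  have 1: "mpoly_eval \<iota> a (Poly_Mapping.single m c * q) =
      mpoly_eval \<iota> a (Poly_Mapping.single m c) * mpoly_eval \<iota> a q" for m c q
    by (induction q rule: mpoly_induct)
      (auto simp: 0 distrib_left mpoly_eval_add[OF assms] mult_single mpoly_eval_single[OF assms]
        hom_mult monom_eval_add mult_ac)
  show ?thesis
    by (induction p rule: mpoly_induct) (auto simp: 0 distrib_right mpoly_eval_add[OF assms] 1)
qed

lemma mrat_eval_Fract:
  fixes \<iota> :: "'a::idom \<Rightarrow> 'b::field"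
  assumes "comm_ring_hom \<iota>" "mpoly_eval \<iota> a q \<noteq> 0"
  shows "mrat_eval \<iota> a (Fract p q) = mpoly_eval \<iota> a p / mpoly_eval \<iota> a q"
  unfolding mrat_eval_def
proof (rule the_equality)
  show "\<exists>p' q'. Fract p q = Fract p' q' \<and> mpoly_eval \<iota> a q' \<noteq> 0 \<and>
      mpoly_eval \<iota> a p / mpoly_eval \<iota> a q = mpoly_eval \<iota> a p' / mpoly_eval \<iota> a q'"
    using assms by blast
next
  fix y assume "\<exists>p' q'. Fract p q = Fract p' q' \<and> mpoly_eval \<iota> a q' \<noteq> 0 \<and>
      y = mpoly_eval \<iota> a p' / mpoly_eval \<iota> a q'"
  then obtain p' q' where *: "Fract p q = Fract p' q'" "mpoly_eval \<iota> a q' \<noteq> 0"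
    "y = mpoly_eval \<iota> a p' / mpoly_eval \<iota> a q'" by blast
  have "q \<noteq> 0" "q' \<noteq> 0" using assms(2) *(2) by (auto simp: mpoly_eval_def)
  with *(1) have "p * q' = p' * q" by (simp add: eq_fract)
  then have "mpoly_eval \<iota> a p * mpoly_eval \<iota> a q' = mpoly_eval \<iota> a p' * mpoly_eval \<iota> a q"
    by (metis mpoly_eval_mult[OF assms(1)])
  with *(2) assms(2) have "mpoly_eval \<iota> a p / mpoly_eval \<iota> a q = mpoly_eval \<iota> a p' / mpoly_eval \<iota> a q'"
    by (simp add: frac_eq_eq)
  with *(3) show "y = mpoly_eval \<iota> a p / mpoly_eval \<iota> a q" by simp
qed

lemma comm_ring_hom_rconst: "comm_ring_hom (rconst :: 'a::idom \<Rightarrow> 'a mrat)"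
  by unfold_locales
    (auto simp: rconst_def single_add mult_single Zero_fract_def One_fract_def single_one)

lemma comm_ring_hom_ident: "comm_ring_hom (\<lambda>c. c)"
  by unfold_locales auto

section \<open>The affine group is a group\<close>

lemma mult_affine_group [simp]:
  "(g, g0) \<otimes>\<^bsub>affine_group n C\<^esub> (h, h0) = (g * h, g *\<^sub>v h0 + g0)"
  by (simp add: affine_group_def)

lemma is_subfield_sum: "is_subfield L \<Longrightarrow> (\<And>i. i \<in> S \<Longrightarrow> f i \<in> L) \<Longrightarrow> sum f S \<in> L"
  by (induction S rule: infinite_finite_induct) (auto simp: is_subfield_def)

lemma is_subfield_prod: "is_subfield L \<Longrightarrow> (\<And>i. i \<in> S \<Longrightarrow> f i \<in> L) \<Longrightarrow> prod f S \<in> L"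
  by (induction S rule: infinite_finite_induct) (auto simp: is_subfield_def)

lemma is_subfield_signof: "is_subfield L \<Longrightarrow> signof p \<in> L"
proof -
  assume L: "is_subfield L"
  then have "0 - 1 \<in> L" unfolding is_subfield_def by blast
  with L show ?thesis by (auto simp: sign_def is_subfield_def)
qed

lemma is_subfield_det:
  assumes "is_subfield L" "A \<in> carrier_mat n n" "\<And>i j. i < n \<Longrightarrow> j < n \<Longrightarrow> A $$ (i, j) \<in> L"
  shows "det A \<in> L"
  unfolding det_def'[OF assms(2)]
proof (rule is_subfield_sum[OF assms(1)])
  fix p assume "p \<in> {p. p permutes {0..<n}}"
  then have "p i < n" if "i < n" for i using that permutes_in_image[of p "{0..<n}" i] by auto
  then have "(\<Prod>i = 0..<n. A $$ (i, p i)) \<in> L"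
    by (intro is_subfield_prod) (use assms in auto)
  with is_subfield_signof[OF assms(1)] assms(1)
  show "signof p * (\<Prod>i = 0..<n. A $$ (i, p i)) \<in> L" by (auto simp: is_subfield_def)
qed

lemma group_affine_group:
  assumes C: "is_subfield C"
  shows "group (affine_group n C)"
proof (rule groupI)
  have neg: "- a \<in> C" if "a \<in> C" for a
  proof -
    from C that have "0 - a \<in> C" unfolding is_subfield_def by blast
    then show ?thesis by simp
  qed
  have S: "a + b \<in> C" "a * b \<in> C" "a / b \<in> C" if "a \<in> C" "b \<in> C" for a b
    using C that by (auto simp: is_subfield_def divide_inverse)
  have mv: "(\<Sum>i = 0..<n. u i * w i) \<in> C" if "\<And>i. i < n \<Longrightarrow> u i \<in> C \<and> w i \<in> C" for u w
    by (rule is_subfield_sum[OF C]) (use that S in auto)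
  fix u v w
  show "\<one>\<^bsub>affine_group n C\<^esub> \<in> carrier (affine_group n C)"
    using C by (auto simp: affine_group_def is_subfield_def)
  assume u: "u \<in> carrier (affine_group n C)"
  show "\<one>\<^bsub>affine_group n C\<^esub> \<otimes>\<^bsub>affine_group n C\<^esub> u = u"
    using u by (auto simp: affine_group_def)
  show "\<exists>y\<in>carrier (affine_group n C). y \<otimes>\<^bsub>affine_group n C\<^esub> u = \<one>\<^bsub>affine_group n C\<^esub>"
  proof -
    obtain h h0 where u': "u = (h, h0)" "h \<in> carrier_mat n n" "h0 \<in> carrier_vec n"
      "\<forall>i<n. \<forall>j<n. h $$ (i, j) \<in> C" "\<forall>i<n. h0 $ i \<in> C" "det h \<noteq> 0"
      using u by (auto simp: affine_group_def)
    define g where "g = (1 / det h) \<cdot>\<^sub>m adj_mat h"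
    note adj = adj_mat[OF u'(2)]
    have g: "g \<in> carrier_mat n n" using adj by (simp add: g_def)
    have gh: "g * h = 1\<^sub>m n"
      using adj u' by (auto simp: g_def mult_smult_assoc_mat[of _ n n _ n] intro!: eq_matI)
    have dh: "det h \<in> C" using is_subfield_det[OF C u'(2)] u'(4) by blast
    have gC: "g $$ (i, j) \<in> C" if "i < n" "j < n" for i j
    proof -
      have "det (mat_delete h j i) \<in> C"
        by (rule is_subfield_det[OF C, where n = "n - 1"])
          (use u'(2,4) that in \<open>auto simp: mat_delete_def\<close>)
      moreover have "1 \<in> C" using C by (auto simp: is_subfield_def)
      moreover from this have "(-1) ^ k \<in> C" for k :: nat
        by (induction k) (auto intro: neg)
      ultimately have "1 / det h * ((-1) ^ (j + i) * det (mat_delete h j i)) \<in> C"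
        using dh by (intro S)
      then show ?thesis
        using that u'(2) by (simp add: g_def adj_mat_def cofactor_def)
    qed
    have "det g * det h = 1" using det_mult[OF g u'(2)] gh by simp
    then have dg: "det g \<noteq> 0" by auto
    have g0: "- (g *\<^sub>v h0) \<in> carrier_vec n" using g u' by auto
    have "(- (g *\<^sub>v h0)) $ i \<in> C" if "i < n" for i
      using that g u' gC by (auto simp: scalar_prod_def intro!: neg mv)
    then have "(g, - (g *\<^sub>v h0)) \<in> carrier (affine_group n C)"
      using g g0 gC dg by (auto simp: affine_group_def)
    moreover have "g *\<^sub>v h0 + - (g *\<^sub>v h0) = 0\<^sub>v n" using g u'
      by (intro eq_vecI) auto
    ultimately show ?thesis using gh u'(1)
      by (intro bexI[of _ "(g, - (g *\<^sub>v h0))"]) (auto simp: affine_group_def)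
  qed
  assume v: "v \<in> carrier (affine_group n C)"
  show "u \<otimes>\<^bsub>affine_group n C\<^esub> v \<in> carrier (affine_group n C)"
    using u v by (auto simp: affine_group_def det_mult scalar_prod_def intro!: S mv)
  assume w: "w \<in> carrier (affine_group n C)"
  show "u \<otimes>\<^bsub>affine_group n C\<^esub> v \<otimes>\<^bsub>affine_group n C\<^esub> w =
    u \<otimes>\<^bsub>affine_group n C\<^esub> (v \<otimes>\<^bsub>affine_group n C\<^esub> w)"
  proof -
    obtain a a0 b b0 c c0 where eqs: "u = (a, a0)" "v = (b, b0)" "w = (c, c0)"
      by (metis surj_pair)
    with u v w have car: "a \<in> carrier_mat n n" "b \<in> carrier_mat n n" "c \<in> carrier_mat n n"
      "a0 \<in> carrier_vec n" "b0 \<in> carrier_vec n" "c0 \<in> carrier_vec n"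
      by (auto simp: affine_group_def)
    have "a * b *\<^sub>v c0 + (a *\<^sub>v b0 + a0) = a *\<^sub>v (b *\<^sub>v c0) + (a *\<^sub>v b0 + a0)"
      using car by (simp only: assoc_mult_mat_vec)
    also have "\<dots> = a *\<^sub>v (b *\<^sub>v c0) + a *\<^sub>v b0 + a0"
      by (rule assoc_add_vec[symmetric, of _ n]) (use car in auto)
    also have "a *\<^sub>v (b *\<^sub>v c0) + a *\<^sub>v b0 = a *\<^sub>v (b *\<^sub>v c0 + b0)"
      by (rule mult_add_distrib_mat_vec[symmetric, of _ n n]) (use car in auto)
    finally show ?thesis
      using assoc_mult_mat[OF car(1-3)] by (simp add: eqs)
  qed
qed

end

(* An element (h, h0) of H acts on E = C<x,d> by f(x) |-> f(hx + h0). This maps the subfield M of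
   functions of x, dx, ..., d^n x to itself, and the generators phi say precisely which elements of M
   are fixed. Let L be the differential field generated by C, the Wronskian quotients and the
   phi_i(x, dx, ..., d^n x). By Cramer's rule d^(n+1) x is a linear combination of dx, ..., d^n x with
   coefficients in L; differentiating this relation puts all derivatives of x, hence all differential
   polynomials, into the L-span of M. So an invariant f satisfies a relation f * b = a with
   a, b in the L-span of M. By Artin's argument M and the fixed field of E are linearly disjoint over
   the fixed field of M, which lies in L; hence f is in L. *)

theory Submission
  imports Defs
begin

section \<open>Polynomials and rational functions over a subset of the coefficients\<close>

text \<open>M is not stable under \<open>d\<close>, and the generators phi say nothing about orders
  above n. Reducing a differential polynomial by the relation for d^(n+1) x therefore does not land
  in M: it mixes elements of M with coefficients from L. Linear disjointness separates the two kinds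
  of factors. It is applied to a relation between numerator and denominator, since the L-span of M
  is a ring but not evidently a field: for f = a / b the relation reads sum (f u_i + v_i) m_i = 0,
  its coefficients are invariant, and the m_i may be replaced by invariant k_i, which lie in L. The
  new relation determines f unless sum u_i k_i = 0, and in that case it shortens the original one.
  The other obstacle is that elements of C<x,d> are values in \<open>'k\<close>, not formal
  expressions. They determine their rational functions because x is generic, and hx + h0 is generic
  again because the formal substitution is injective. As h and h0 are constant, d^m (hx + h0) is h
  d^m x, plus h0 if m = 0; so the action on the columns z is the action on jets.\<close>

lemma mpolys_iff:
  "p \<in> mpolys C V \<longleftrightarrow>
     (\<forall>m. Poly_Mapping.lookup p m \<in> C) \<and> (\<forall>m \<in> Poly_Mapping.keys p. Poly_Mapping.keys m \<subseteq> V)"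
  by (auto simp: mpolys_def)

lemma mpolys_mono: "C \<subseteq> C' \<Longrightarrow> V \<subseteq> V' \<Longrightarrow> mpolys C V \<subseteq> mpolys C' V'"
  by (fastforce simp: mpolys_iff)

lemma mrats_mono: "C \<subseteq> C' \<Longrightarrow> V \<subseteq> V' \<Longrightarrow> mrats C V \<subseteq> mrats C' V'"
  using mpolys_mono[of C C' V V'] by (fastforce simp: mrats_def)

lemma mpolys_single:
  "0 \<in> C \<Longrightarrow> c \<in> C \<Longrightarrow> Poly_Mapping.keys m \<subseteq> V \<Longrightarrow> Poly_Mapping.single m c \<in> mpolys C V"
  by (auto simp: mpolys_iff lookup_single when_def split: if_splits)

lemma mpolys_zero: "0 \<in> C \<Longrightarrow> 0 \<in> mpolys C V"
  by (auto simp: mpolys_iff)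

lemma mpolys_one: "0 \<in> C \<Longrightarrow> 1 \<in> C \<Longrightarrow> 1 \<in> mpolys C V"
  by (metis mpolys_single single_one keys_zero empty_subsetI)

lemma mpolys_add:
  assumes "\<And>a b. a \<in> C \<Longrightarrow> b \<in> C \<Longrightarrow> a + b \<in> C" "p \<in> mpolys C V" "q \<in> mpolys C V"
  shows "p + q \<in> mpolys C V"
  using assms keys_add[of p q] by (fastforce simp: mpolys_iff lookup_add)

lemma mpolys_sum:
  assumes "0 \<in> C" "\<And>a b. a \<in> C \<Longrightarrow> b \<in> C \<Longrightarrow> a + b \<in> C" "\<And>i. i \<in> I \<Longrightarrow> p i \<in> mpolys C V"
  shows "sum p I \<in> mpolys C V"
  using assms(3)
  by (induction I rule: infinite_finite_induct) (auto intro!: mpolys_zero mpolys_add assms(1,2))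

lemma mpoly_monomials:
  "p = (\<Sum>m\<in>Poly_Mapping.keys p. Poly_Mapping.single m (Poly_Mapping.lookup p m))"
  by (rule poly_mapping_eqI) (auto simp: lookup_sum lookup_single when_def in_keys_iff)

lemma mpolys_mult:
  fixes C :: "'a::comm_ring_1 set"
  assumes "0 \<in> C" "\<And>a b. a \<in> C \<Longrightarrow> b \<in> C \<Longrightarrow> a + b \<in> C" "\<And>a b. a \<in> C \<Longrightarrow> b \<in> C \<Longrightarrow> a * b \<in> C"
    and "p \<in> mpolys C V" "q \<in> mpolys C V"
  shows "p * q \<in> mpolys C V"
proof -
  have "p * q = (\<Sum>m\<in>Poly_Mapping.keys p. \<Sum>l\<in>Poly_Mapping.keys q.
      Poly_Mapping.single (m + l) (Poly_Mapping.lookup p m * Poly_Mapping.lookup q l))"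
    by (subst mpoly_monomials[of p], subst mpoly_monomials[of q])
      (simp add: sum_product mult_single)
  also have "\<dots> \<in> mpolys C V"
  proof (intro mpolys_sum mpolys_single assms(1,2,3))
    fix m l assume "m \<in> Poly_Mapping.keys p" "l \<in> Poly_Mapping.keys q"
    then show "Poly_Mapping.keys (m + l) \<subseteq> V"
      using keys_add[of m l] assms(4,5) unfolding mpolys_iff by blast
  qed (use assms(4,5) in \<open>auto simp: mpolys_iff\<close>)
  finally show ?thesis .
qed

text \<open>Polynomials arise from constants and variables by sums and products. The constants 0 and
  1 are added by hand because \<open>C\<close> is an arbitrary set: 1 starts the powers of a
  variable, and 0 is the empty sum.\<close>

lemma mpolys_induct [consumes 1, case_names const var add mult]:
  fixes C :: "'a::comm_ring_1 set"
  assumes p: "p \<in> mpolys C V"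
    and const: "\<And>c. c \<in> insert 0 (insert 1 C) \<Longrightarrow> P (Poly_Mapping.single 0 c)"
    and var: "\<And>v. v \<in> V \<Longrightarrow> P (Poly_Mapping.single (Poly_Mapping.single v 1) 1)"
    and add: "\<And>p q. P p \<Longrightarrow> P q \<Longrightarrow> P (p + q)"
    and mult: "\<And>p q. P p \<Longrightarrow> P q \<Longrightarrow> P (p * q)"
  shows "P p"
proof -
  have P1: "P 1" using const[of 1] by (simp add: single_one)
  have pow: "P (Poly_Mapping.single (Poly_Mapping.single v k) 1)" if "v \<in> V" for v k
  proof (induction k)
    case (Suc k)
    have "Poly_Mapping.single (Poly_Mapping.single v (Suc k)) (1::'a) =
        Poly_Mapping.single (Poly_Mapping.single v 1) 1 * Poly_Mapping.single (Poly_Mapping.single v k) 1"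
      by (simp add: mult_single single_add[symmetric])
    then show ?case using mult[OF var[OF that] Suc] by simp
  qed (simp add: P1 single_one)
  have mono: "Poly_Mapping.keys m \<subseteq> V \<longrightarrow> P (Poly_Mapping.single m c)" if "c \<in> C" for m c
  \<comment> \<open>An exponent vector is itself a finitely supported map, so the same rule builds
    it up one variable at a time.\<close>
  proof (induction m rule: mpoly_induct)
    case zero
    then show ?case using const that by simp
  next
    case (add m v k)
    have eq: "Poly_Mapping.single (Poly_Mapping.single v k + m) c =
        Poly_Mapping.single (Poly_Mapping.single v k) 1 * Poly_Mapping.single m c"
      by (simp add: mult_single)
    show ?case
    \<comment> \<open>For \<open>k = 0\<close> nothing is added and \<open>v\<close> need not lie in
      \<open>V\<close>. Otherwise no key is lost in the sum, since natural exponents cannot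
      cancel.\<close>
    proof (cases "k = 0")
      case False
      show ?thesis
      proof
        assume "Poly_Mapping.keys (Poly_Mapping.single v k + m) \<subseteq> V"
        moreover have "insert v (Poly_Mapping.keys m) \<subseteq> Poly_Mapping.keys (Poly_Mapping.single v k + m)"
          using False by (auto simp: in_keys_iff lookup_add)
        ultimately show "P (Poly_Mapping.single (Poly_Mapping.single v k + m) c)"
          unfolding eq using add by (intro mult pow) auto
      qed
    qed (use add in simp)
  qed
  have "P (sum f I)" if "\<And>i. i \<in> I \<Longrightarrow> P (f i)" for f and I :: "((nat \<times> nat) \<Rightarrow>\<^sub>0 nat) set"
    using that by (induction I rule: infinite_finite_induct) (use const[of 0] in \<open>auto intro: add\<close>)
  with p mono show ?thesis
    by (subst mpoly_monomials[of p]) (auto simp: mpolys_iff)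
qed

section \<open>Evaluation as a ring homomorphism, and the field of rational functions\<close>

lemma comm_ring_hom_mpoly_eval:
  assumes "comm_ring_hom \<iota>"
  shows "comm_ring_hom (mpoly_eval \<iota> a)"
proof -
  interpret comm_ring_hom \<iota> by fact
  show ?thesis
    by unfold_locales
      (auto simp: mpoly_eval_add[OF assms] mpoly_eval_mult[OF assms] single_one[symmetric]
        mpoly_eval_single[OF assms] simp del: single_one, simp add: mpoly_eval_def)
qed

lemma mpoly_eval_var:
  assumes "comm_ring_hom \<iota>"
  shows "mpoly_eval \<iota> a (Poly_Mapping.single (Poly_Mapping.single v 1) 1) = a v"
proof -
  interpret comm_ring_hom \<iota> by fact
  show ?thesis by (simp add: mpoly_eval_single[OF assms])
qed

lemma mpoly_eval_const:
  assumes "comm_ring_hom \<iota>"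
  shows "mpoly_eval \<iota> a (Poly_Mapping.single 0 c) = \<iota> c"
  by (simp add: mpoly_eval_single[OF assms])

lemma mpoly_eval_cong:
  assumes "p \<in> mpolys C V" "\<And>v. v \<in> V \<Longrightarrow> a v = b v"
  shows "mpoly_eval \<iota> a p = mpoly_eval \<iota> b p"
proof -
  have "(\<Prod>v\<in>Poly_Mapping.keys m. a v ^ Poly_Mapping.lookup m v) =
      (\<Prod>v\<in>Poly_Mapping.keys m. b v ^ Poly_Mapping.lookup m v)" if "m \<in> Poly_Mapping.keys p" for m
    using assms(1) that by (intro prod.cong refl arg_cong2[of _ _ _ _ "(^)"] assms(2)) (auto simp: mpolys_iff)
  then show ?thesis by (simp add: mpoly_eval_def)
qed

text \<open>With \<theta> an evaluation this computes the value of a substituted polynomial; with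
  \<theta> the embedding into fractions it compares substitution among polynomials with substitution
  among rational functions.\<close>

lemma hom_mpoly_eval:
  assumes "comm_ring_hom \<theta>"
  shows "\<theta> (mpoly_eval \<iota> a p) = mpoly_eval (\<lambda>c. \<theta> (\<iota> c)) (\<lambda>v. \<theta> (a v)) p"
proof -
  interpret comm_ring_hom \<theta> by fact
  show ?thesis by (simp add: mpoly_eval_def hom_sum hom_mult hom_prod hom_power)
qed

lemma comm_ring_hom_single: "comm_ring_hom (Poly_Mapping.single 0 :: 'a::comm_ring_1 \<Rightarrow> 'a mpoly)"
  by unfold_locales (auto simp: single_add mult_single single_one)

lemma comm_ring_hom_Fract: "comm_ring_hom (\<lambda>p::'a::idom. Fract p 1)"
  by unfold_locales (auto simp: Zero_fract_def One_fract_def)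

lemma is_subfield_mrats:
  fixes C :: "'a::field set"
  assumes C: "is_subfield C"
  shows "is_subfield (mrats C V)"
proof -
  have C': "0 \<in> C" "1 \<in> C" "\<And>a b. a \<in> C \<Longrightarrow> b \<in> C \<Longrightarrow> a + b \<in> C"
    "\<And>a b. a \<in> C \<Longrightarrow> b \<in> C \<Longrightarrow> a * b \<in> C" "\<And>a b. a \<in> C \<Longrightarrow> b \<in> C \<Longrightarrow> a - b \<in> C"
    using C by (auto simp: is_subfield_def)
  have m: "p * q \<in> mpolys C V" if "p \<in> mpolys C V" "q \<in> mpolys C V" for p q
    using mpolys_mult[OF C'(1,3,4) that] by simp
  have a: "p + q \<in> mpolys C V" if "p \<in> mpolys C V" "q \<in> mpolys C V" for p q
    using mpolys_add[OF C'(3) that] by simp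
  have "0 - 1 \<in> C" using C' by blast
  then have neg: "Poly_Mapping.single 0 (-1) \<in> mpolys C V" using C' by (intro mpolys_single) auto
  have minus: "p - q \<in> mpolys C V" if "p \<in> mpolys C V" "q \<in> mpolys C V" for p q
  proof -
    have "p - q = p + Poly_Mapping.single 0 (-1) * q" by (simp add: single_uminus single_one)
    also have "\<dots> \<in> mpolys C V" by (rule a[OF that(1) m[OF neg that(2)]])
    finally show ?thesis .
  qed
  \<comment> \<open>The case \<open>q = 0\<close> is included for the sake of inverses:
    \<open>inverse (Fract p q)\<close> is \<open>Fract q p\<close> even if \<open>p = 0\<close>, and
    a fraction with denominator 0 is 0.\<close>
  have frac: "Fract p q \<in> mrats C V" if "p \<in> mpolys C V" "q \<in> mpolys C V" for p q
  proof (cases "q = 0")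
    case True
    then have "Fract p q = Fract 0 1" by (simp add: fract_collapse)
    moreover have "Fract 0 1 \<in> mrats C V"
      using mpolys_zero[OF C'(1)] mpolys_one[OF C'(1,2)] unfolding mrats_def by fastforce
    ultimately show ?thesis by simp
  qed (use that in \<open>auto simp: mrats_def\<close>)
  show ?thesis unfolding is_subfield_def
  proof (intro conjI ballI)
    show "0 \<in> mrats C V" unfolding Zero_fract_def by (intro frac mpolys_zero mpolys_one C')
    show "1 \<in> mrats C V" unfolding One_fract_def by (intro frac mpolys_zero mpolys_one C')
  next
    fix r s assume "r \<in> mrats C V" "s \<in> mrats C V"
    then obtain p q p' q' where "r = Fract p q" "s = Fract p' q'" "q \<noteq> 0" "q' \<noteq> 0"
      "p \<in> mpolys C V" "q \<in> mpolys C V" "p' \<in> mpolys C V" "q' \<in> mpolys C V"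
      by (auto simp: mrats_def)
    then show "r + s \<in> mrats C V" "r - s \<in> mrats C V" "r * s \<in> mrats C V"
      by (auto intro!: frac a m minus)
  next
    fix r assume "r \<in> mrats C V"
    then obtain p q where "r = Fract p q" "p \<in> mpolys C V" "q \<in> mpolys C V"
      by (auto simp: mrats_def)
    then show "inverse r \<in> mrats C V" by (simp add: frac)
  qed
qed

section \<open>Spans over a subfield and linear disjointness from the fixed field\<close>

lemma is_subfieldD:
  assumes "is_subfield L"
  shows "0 \<in> L" "1 \<in> L" "a \<in> L \<Longrightarrow> b \<in> L \<Longrightarrow> a + b \<in> L" "a \<in> L \<Longrightarrow> b \<in> L \<Longrightarrow> a - b \<in> L"
    "a \<in> L \<Longrightarrow> b \<in> L \<Longrightarrow> a * b \<in> L" "a \<in> L \<Longrightarrow> inverse a \<in> L" "a \<in> L \<Longrightarrow> b \<in> L \<Longrightarrow> a / b \<in> L"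
    "a \<in> L \<Longrightarrow> - a \<in> L"
proof -
  show "a \<in> L \<Longrightarrow> - a \<in> L"
    using assms unfolding is_subfield_def by (metis diff_0)
qed (use assms in \<open>auto simp: is_subfield_def divide_inverse\<close>)

text \<open>Scalars and vectors are subsets of the same type. Zero is not built in but arises as
  \<open>0 * b\<close>, which needs some \<open>b\<close> in \<open>B\<close>; hence the first
  premise of \<open>lspan_sum\<close>.\<close>

inductive_set lspan :: "'a::semiring_0 set \<Rightarrow> 'a set \<Rightarrow> 'a set" for L B where
  scale: "l \<in> L \<Longrightarrow> b \<in> B \<Longrightarrow> l * b \<in> lspan L B"
| add: "a \<in> lspan L B \<Longrightarrow> b \<in> lspan L B \<Longrightarrow> a + b \<in> lspan L B"

lemma lspan_mono: "a \<in> lspan L B \<Longrightarrow> B \<subseteq> B' \<Longrightarrow> a \<in> lspan L B'"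
  by (induction rule: lspan.induct) (auto intro: lspan.intros)

lemma lspan_scale:
  assumes "\<And>a b. a \<in> L \<Longrightarrow> b \<in> L \<Longrightarrow> a * b \<in> L" "l \<in> L" "a \<in> lspan L B"
  shows "l * a \<in> lspan L B"
  using assms(3)
  by (induction rule: lspan.induct)
    (auto intro: lspan.intros assms simp: distrib_left mult.assoc[symmetric])

text \<open>If \<open>B\<close> is a subfield, the span is thus closed under products, so it
  contains all differential polynomials as soon as it contains the constants and the derivatives of
  x.\<close>

lemma lspan_mult:
  fixes L B :: "'a::comm_ring set"
  assumes L: "\<And>a b. a \<in> L \<Longrightarrow> b \<in> L \<Longrightarrow> a * b \<in> L"
    and B: "\<And>a b. a \<in> B \<Longrightarrow> b \<in> B \<Longrightarrow> a * b \<in> B"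
    and "a \<in> lspan L B" "b \<in> lspan L B"
  shows "a * b \<in> lspan L B"
  using assms(3)
proof (induction rule: lspan.induct)
  case (scale l x)
  from assms(4) show ?case
  proof (induction rule: lspan.induct)
    case (scale l' x')
    have "l * x * (l' * x') = (l * l') * (x * x')" by (simp add: ac_simps)
    also have "\<dots> \<in> lspan L B" by (intro lspan.scale L B scale.hyps \<open>l \<in> L\<close> \<open>x \<in> B\<close>)
    finally show ?case .
  qed (auto simp: distrib_left intro: lspan.add)
qed (auto simp: distrib_right intro: lspan.add)

lemma lspan_sum:
  assumes "0 \<in> lspan L B" "\<And>i. i \<in> I \<Longrightarrow> f i \<in> lspan L B"
  shows "sum f I \<in> lspan L B"
  using assms(2)
  by (induction I rule: infinite_finite_induct) (auto intro: assms(1) lspan.add)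

text \<open>The coefficient function is total and vanishes off \<open>S\<close>, so that two
  elements of the span can be rewritten over a common finite index set.\<close>

lemma lspan_explicit:
  fixes L :: "'a::comm_ring_1 set"
  assumes L: "0 \<in> L" "\<And>a b. a \<in> L \<Longrightarrow> b \<in> L \<Longrightarrow> a + b \<in> L" and a: "a \<in> lspan L B"
  shows "\<exists>S c. finite S \<and> S \<subseteq> B \<and> range c \<subseteq> L \<and> (\<forall>b. b \<notin> S \<longrightarrow> c b = 0) \<and> a = (\<Sum>b\<in>S. c b * b)"
  using a
proof (induction rule: lspan.induct)
  case (scale l b)
  then show ?case
    by (intro exI[of _ "{b}"] exI[of _ "\<lambda>x. if x = b then l else 0"]) (auto intro: L)
next
  case (add a b)
  from add.IH(1) obtain S c where S: "finite S" "S \<subseteq> B" "range c \<subseteq> L" "\<forall>b. b \<notin> S \<longrightarrow> c b = 0"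
    "a = (\<Sum>b\<in>S. c b * b)" by blast
  from add.IH(2) obtain T e where T: "finite T" "T \<subseteq> B" "range e \<subseteq> L" "\<forall>b. b \<notin> T \<longrightarrow> e b = 0"
    "b = (\<Sum>b\<in>T. e b * b)" by blast
  have "a = (\<Sum>b\<in>S \<union> T. c b * b)" unfolding S(5)
    using S T by (intro sum.mono_neutral_left) auto
  moreover have "b = (\<Sum>b\<in>S \<union> T. e b * b)" unfolding T(5)
    using S T by (intro sum.mono_neutral_left) auto
  moreover have "range (\<lambda>x. c x + e x) \<subseteq> L" using S(3) T(3) by (auto intro: L)
  ultimately show ?case using S(1,2,4) T(1,2,4)
    by (intro exI[of _ "S \<union> T"] exI[of _ "\<lambda>x. c x + e x"])
      (simp add: distrib_right sum.distrib)
qed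

text \<open>The maps are homomorphisms on \<open>E\<close> with values in the ambient field,
  unconstrained outside \<open>E\<close>. Stability is demanded of \<open>M\<close>, since the
  multipliers in a relation must stay in \<open>M\<close> when a map is applied.\<close>

locale field_homs =
  fixes E M :: "'k::field set" and G :: "('k \<Rightarrow> 'k) set"
  assumes E: "is_subfield E" and M: "is_subfield M" and ME: "M \<subseteq> E"
    and hom_1: "s \<in> G \<Longrightarrow> s 1 = 1"
    and hom_add: "s \<in> G \<Longrightarrow> a \<in> E \<Longrightarrow> b \<in> E \<Longrightarrow> s (a + b) = s a + s b"
    and hom_mult: "s \<in> G \<Longrightarrow> a \<in> E \<Longrightarrow> b \<in> E \<Longrightarrow> s (a * b) = s a * s b"
    and hom_M: "s \<in> G \<Longrightarrow> a \<in> M \<Longrightarrow> s a \<in> M"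
begin

definition fixed :: "'k set \<Rightarrow> 'k set" where
  "fixed A = {a \<in> A. \<forall>s\<in>G. s a = a}"

lemma hom_0: "s \<in> G \<Longrightarrow> s 0 = 0"
  using hom_add[of s 0 0] is_subfieldD(1)[OF E] by (metis add.right_neutral add_left_cancel)

lemma hom_sum: "s \<in> G \<Longrightarrow> (\<And>i. i \<in> I \<Longrightarrow> f i \<in> E) \<Longrightarrow> s (sum f I) = (\<Sum>i\<in>I. s (f i))"
  by (induction I rule: infinite_finite_induct)
    (auto simp: hom_0 hom_add is_subfield_sum[OF E])

lemma is_subfield_fixed: "is_subfield (fixed E)"
proof -
  have diff: "s (a - b) = s a - s b" if "s \<in> G" "a \<in> E" "b \<in> E" for s a b
    using hom_add[OF that(1) is_subfieldD(4)[OF E that(2,3)] that(3)] by (simp add: algebra_simps)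
  have inv: "s (inverse a) = inverse (s a)" if "s \<in> G" "a \<in> E" for s a
  proof (cases "a = 0")
    case True
    then show ?thesis using that by (simp add: hom_0)
  next
    case False
    have "s a * s (inverse a) = 1"
      using hom_mult[OF that is_subfieldD(6)[OF E that(2)]] False that by (simp add: hom_1)
    then show ?thesis by (metis inverse_unique)
  qed
  show ?thesis
    unfolding is_subfield_def
    by (auto simp: fixed_def hom_0 hom_1 hom_add hom_mult diff inv intro: is_subfieldD[OF E])
qed

text \<open>A map in \<open>G\<close> leaves the \<open>c i\<close> alone, so subtracting the image
  of a relation from the relation gives another one over \<open>M\<close>. If one entry is scaled to
  1, that entry disappears in the difference. A shortest nontrivial relation, so scaled, must
  therefore be fixed by \<open>G\<close>.\<close>

lemma artin_relation:
  assumes I: "finite I" and c: "\<And>i. i \<in> I \<Longrightarrow> c i \<in> fixed E" and m: "\<And>i. i \<in> I \<Longrightarrow> m i \<in> M"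
    and nz: "\<exists>i\<in>I. m i \<noteq> 0" and rel: "(\<Sum>i\<in>I. c i * m i) = 0"
  shows "\<exists>k. (\<forall>i\<in>I. k i \<in> fixed M) \<and> (\<exists>i\<in>I. k i \<noteq> 0) \<and> (\<Sum>i\<in>I. c i * k i) = 0"
  using m nz rel
proof (induction "card {i\<in>I. m i \<noteq> 0}" arbitrary: m rule: less_induct)
  case less
  obtain j where j: "j \<in> I" "m j \<noteq> 0" using less.prems(2) by blast
  define k where "k i = m i / m j" for i
  have kM: "k i \<in> M" if "i \<in> I" for i
    using less.prems(1) that j by (auto simp: k_def intro: is_subfieldD[OF M])
  have kj: "k j = 1" using j by (simp add: k_def)
  have rel: "(\<Sum>i\<in>I. c i * k i) = 0"
    using less.prems(3) by (simp add: k_def sum_divide_distrib[symmetric])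
  show ?case
  proof (cases "\<forall>i\<in>I. \<forall>s\<in>G. s (k i) = k i")
    case True
    then have "k i \<in> fixed M" if "i \<in> I" for i
      using kM[OF that] that unfolding fixed_def by blast
    moreover have "\<exists>i\<in>I. k i \<noteq> 0" using j kj by (metis zero_neq_one)
    ultimately show ?thesis using rel by blast
  next
    case False
    then obtain i s where wit: "i \<in> I" "s \<in> G" "s (k i) \<noteq> k i" by blast
    \<comment> \<open>Since \<open>k j = 1\<close>, this is a nontrivial relation of smaller support.\<close>
    define m' where "m' i = k i - s (k i)" for i
    have "s (\<Sum>i\<in>I. c i * k i) = (\<Sum>i\<in>I. s (c i * k i))"
      using kM ME c by (intro hom_sum wit) (auto simp: fixed_def intro!: is_subfieldD[OF E])
    also have "\<dots> = (\<Sum>i\<in>I. c i * s (k i))"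
      using kM ME c wit by (intro sum.cong refl, subst hom_mult) (auto simp: fixed_def)
    finally have "(\<Sum>i\<in>I. c i * s (k i)) = 0" using rel wit by (simp add: hom_0)
    with rel have rel': "(\<Sum>i\<in>I. c i * m' i) = 0"
      by (simp add: m'_def right_diff_distrib sum_subtractf)
    have "m' j = 0" using kj wit by (simp add: m'_def hom_1)
    moreover have "m' i = 0" if "m i = 0" for i using that wit by (simp add: m'_def k_def hom_0)
    ultimately have "{i\<in>I. m' i \<noteq> 0} \<subset> {i\<in>I. m i \<noteq> 0}" using j by blast
    then have "card {i\<in>I. m' i \<noteq> 0} < card {i\<in>I. m i \<noteq> 0}"
      using I by (intro psubset_card_mono) auto
    moreover have "m' i \<in> M" if "i \<in> I" for i
      unfolding m'_def by (intro is_subfieldD(4)[OF M] kM that hom_M[OF wit(2)])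
    moreover have "\<exists>i\<in>I. m' i \<noteq> 0" using wit(1,3) by (intro bexI[of _ i]) (auto simp: m'_def)
    ultimately show ?thesis using rel' by (intro less.hyps)
  qed
qed

text \<open>All coefficients \<open>f * u i + v i\<close> are fixed, so
  \<open>artin_relation\<close> gives \<open>f * U + V = 0\<close> with \<open>U\<close> and
  \<open>V\<close> in \<open>L\<close>, which can be solved for \<open>f\<close> unless
  \<open>U = 0\<close>. In that case also \<open>V = 0\<close>, and an index is eliminated without
  changing the sums of \<open>u i * m i\<close> and \<open>v i * m i\<close>. The nonzero sum keeps
  the index set from becoming empty.\<close>

lemma fixed_relation_imp_mem:
  assumes L: "is_subfield L" and LE: "L \<subseteq> fixed E" and fixM: "fixed M \<subseteq> L" and f: "f \<in> fixed E"
    and "finite I" "\<And>i. i \<in> I \<Longrightarrow> u i \<in> L" "\<And>i. i \<in> I \<Longrightarrow> v i \<in> L" "\<And>i. i \<in> I \<Longrightarrow> m i \<in> M"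
    and "(\<Sum>i\<in>I. u i * m i) \<noteq> 0" "(\<Sum>i\<in>I. (f * u i + v i) * m i) = 0"
  shows "f \<in> L"
  using assms(5-)
proof (induction "card I" arbitrary: I m rule: less_induct)
  case less
  note fin = less.prems(1) and u = less.prems(2) and v = less.prems(3) and m = less.prems(4)
    and nz = less.prems(5) and rel = less.prems(6)
  have c: "f * u i + v i \<in> fixed E" if "i \<in> I" for i
  proof -
    have "f \<in> E" "u i \<in> E" "v i \<in> E" "f * u i \<in> E"
      using LE f u[OF that] v[OF that] by (auto simp: fixed_def intro!: is_subfieldD[OF E])
    moreover have "s (f * u i + v i) = f * u i + v i" if s: "s \<in> G" for s
    proof -
      have "s f = f" "s (u i) = u i" "s (v i) = v i"
        using LE f u[OF \<open>i \<in> I\<close>] v[OF \<open>i \<in> I\<close>] s unfolding fixed_def by blast+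
      with calculation s show ?thesis by (simp add: hom_add hom_mult)
    qed
    ultimately show ?thesis by (auto simp: fixed_def intro: is_subfieldD[OF E])
  qed
  have "\<exists>i\<in>I. m i \<noteq> 0" using nz by (rule contrapos_np) simp
  then have "\<exists>k. (\<forall>i\<in>I. k i \<in> fixed M) \<and> (\<exists>i\<in>I. k i \<noteq> 0) \<and> (\<Sum>i\<in>I. (f * u i + v i) * k i) = 0"
    by (intro artin_relation[OF fin c m _ rel])
  then obtain k where
    k': "\<forall>i\<in>I. k i \<in> fixed M" and k: "\<exists>i\<in>I. k i \<noteq> 0" "(\<Sum>i\<in>I. (f * u i + v i) * k i) = 0"
    by (elim exE conjE)
  note kM = bspec[OF k']
  define U where "U = (\<Sum>i\<in>I. u i * k i)"
  define V where "V = (\<Sum>i\<in>I. v i * k i)"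
  have UV: "f * U + V = 0" using k(2)
    by (simp add: U_def V_def distrib_right sum.distrib sum_distrib_left mult.assoc)
  have UVL: "U \<in> L" "V \<in> L"
    using kM fixM u v by (auto simp: U_def V_def intro!: is_subfield_sum[OF L] is_subfieldD[OF L])
  show ?case
  proof (cases "U = 0")
    case False
    with UV have "f = - V / U" by (simp add: field_simps eq_neg_iff_add_eq_0)
    with UVL show ?thesis by (auto intro!: is_subfieldD[OF L])
  next
    case True
    obtain j where j: "j \<in> I" "k j \<noteq> 0" using k(1) by blast
    \<comment> \<open>Now \<open>k\<close> is a relation for both \<open>u\<close> and \<open>v\<close>, so the index \<open>j\<close> can be eliminated.\<close>
    define m' where "m' i = m i - k i / k j * m j" for i
    have elim: "(\<Sum>i\<in>I - {j}. w i * m' i) = (\<Sum>i\<in>I. w i * m i)" if "(\<Sum>i\<in>I. w i * k i) = 0" for w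
    proof -
      have "(\<Sum>i\<in>I - {j}. w i * m' i) = (\<Sum>i\<in>I. w i * m' i)"
        using j fin by (intro sum.mono_neutral_left) (auto simp: m'_def)
      also have "\<dots> = (\<Sum>i\<in>I. w i * m i) - (\<Sum>i\<in>I. w i * k i) * (m j / k j)"
        unfolding m'_def right_diff_distrib sum_subtractf sum_distrib_right by (simp add: ac_simps)
      finally show ?thesis using that by simp
    qed
    show ?thesis
    proof (rule less.hyps[of "I - {j}" m'])
      show "card (I - {j}) < card I" using j fin by (meson card_Diff1_less)
      show "m' i \<in> M" if "i \<in> I - {j}" for i
        using that m kM j by (auto simp: m'_def fixed_def intro!: is_subfieldD[OF M])
      show "(\<Sum>i\<in>I - {j}. u i * m' i) \<noteq> 0" using elim[of u] True nz by (simp add: U_def)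
      show "(\<Sum>i\<in>I - {j}. (f * u i + v i) * m' i) = 0"
        using elim[of "\<lambda>i. f * u i + v i"] k(2) rel by simp
    qed (use fin u v in auto)
  qed
qed

text \<open>Clearing the denominator in \<open>f = a / b\<close> gives a relation for
  \<open>fixed_relation_imp_mem\<close>: \<open>u\<close> holds the coefficients of
  \<open>b\<close>, \<open>v\<close> the negated coefficients of \<open>a\<close>, and the
  multipliers are the elements of the common index set themselves.\<close>

lemma fixed_quotient_mem:
  assumes L: "is_subfield L" and LE: "L \<subseteq> fixed E" and fixM: "fixed M \<subseteq> L"
    and "a / b \<in> fixed E" "a \<in> lspan L M" "b \<in> lspan L M" "b \<noteq> 0"
  shows "a / b \<in> L"
proof -
  note L' = is_subfieldD(1,3)[OF L]
  obtain S c where S: "finite S" "S \<subseteq> M" "range c \<subseteq> L" "\<forall>b. b \<notin> S \<longrightarrow> c b = 0" "a = (\<Sum>b\<in>S. c b * b)"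
    using lspan_explicit[OF L' assms(5)] by blast
  obtain T e where T: "finite T" "T \<subseteq> M" "range e \<subseteq> L" "\<forall>b. b \<notin> T \<longrightarrow> e b = 0" "b = (\<Sum>b\<in>T. e b * b)"
    using lspan_explicit[OF L' assms(6)] by blast
  have a: "a = (\<Sum>b\<in>S \<union> T. c b * b)" unfolding S(5)
    using S T by (intro sum.mono_neutral_left) auto
  have b: "b = (\<Sum>b\<in>S \<union> T. e b * b)" unfolding T(5)
    using S T by (intro sum.mono_neutral_left) auto
  have "(\<Sum>y\<in>S \<union> T. (a / b * e y + - c y) * y) =
      a / b * (\<Sum>y\<in>S \<union> T. e y * y) - (\<Sum>y\<in>S \<union> T. c y * y)"
    by (simp add: left_diff_distrib sum_subtractf sum_distrib_left mult.assoc)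
  also have "\<dots> = 0" using assms(7) by (simp flip: a b)
  finally have rel: "(\<Sum>y\<in>S \<union> T. (a / b * e y + - c y) * y) = 0" .
  show ?thesis
  proof (rule fixed_relation_imp_mem[OF L LE fixM assms(4) _ _ _ _ _ rel])
    show "(\<Sum>y\<in>S \<union> T. e y * y) \<noteq> 0" using assms(7) by (simp flip: b)
  qed (use S T in \<open>auto intro!: is_subfieldD(8)[OF L]\<close>)
qed

end

section \<open>Derivations and generic points\<close>

lemma derivationD:
  assumes "derivation d"
  shows derivation_add: "d (a + b) = d a + d b" and derivation_mult: "d (a * b) = d a * b + a * d b"
    and derivation_0: "d 0 = 0" and derivation_1: "d 1 = 0" and derivation_diff: "d (a - b) = d a - d b"
    and derivation_divide: "b \<noteq> 0 \<Longrightarrow> d (a / b) = (d a * b - a * d b) / (b * b)"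
proof -
  show add: "d (a + b) = d a + d b" for a b using assms by (simp add: derivation_def)
  show mult: "d (a * b) = d a * b + a * d b" for a b using assms by (simp add: derivation_def)
  show "d 0 = 0" using add[of 0 0] by (metis add.right_neutral add_left_cancel)
  have "d 1 + 0 = d 1 + d 1" using mult[of 1 1] by simp
  then show "d 1 = 0" by (metis add_left_cancel)
  show "d (a - b) = d a - d b" using add[of "a - b" b] by (simp add: algebra_simps)
  show "d (a / b) = (d a * b - a * d b) / (b * b)" if "b \<noteq> 0"
    using mult[of "a / b" b] that by (simp add: field_simps)
qed

lemma derivation_sum: "derivation d \<Longrightarrow> d (sum f I) = (\<Sum>i\<in>I. d (f i))"
  by (induction I rule: infinite_finite_induct) (auto simp: derivation_0 derivation_add)

lemma is_subfield_const_field: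
  assumes d: "derivation d" and F: "is_diff_subfield d F"
  shows "is_subfield (const_field d F)"
proof -
  have F': "is_subfield F" using F by (simp add: is_diff_subfield_def)
  have "d (inverse a) = 0" if "d a = 0" for a
    using derivation_divide[OF d, of a 1] that
    by (cases "a = 0") (auto simp: derivation_0[OF d] derivation_1[OF d] inverse_eq_divide)
  then show ?thesis unfolding is_subfield_def const_field_def
    using is_subfieldD[OF F'] derivationD[OF d] by auto
qed

text \<open>Constant coefficients pass through \<open>d\<close>, and the constant term dies at the
  first differentiation. This is the pattern of \<open>zcol_act\<close>, where only column 0 is
  translated.\<close>

lemma derivation_pow_affine:
  assumes d: "derivation d" and h: "\<And>k. k \<in> K \<Longrightarrow> d (h k) = 0" and c: "d c = 0"
  shows "(d ^^ m) ((\<Sum>k\<in>K. h k * y k) + c) =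
    (\<Sum>k\<in>K. h k * (d ^^ m) (y k)) + (if m = 0 then c else 0)"
proof (induction m)
  case (Suc m)
  then show ?case
    by (simp add: derivationD[OF d] derivation_sum[OF d] c h cong: sum.cong)
qed simp

section \<open>Rational functions at generic points\<close>

abbreviation mpoly_var :: "nat \<times> nat \<Rightarrow> 'a::comm_ring_1 mpoly" where
  "mpoly_var v \<equiv> Poly_Mapping.single (Poly_Mapping.single v 1) 1"

text \<open>At a generic point no denominator vanishes, so \<^const>\<open>mrat_eval\<close> is never a junk value there.\<close>

definition generic_point :: "'k::field set \<Rightarrow> (nat \<times> nat) set \<Rightarrow> (nat \<times> nat \<Rightarrow> 'k) \<Rightarrow> bool" where
  "generic_point C V a \<longleftrightarrow> (\<forall>p \<in> mpolys C V. mpoly_eval (\<lambda>c. c) a p = 0 \<longrightarrow> p = 0)"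

text \<open>One pair \<open>p\<close>, \<open>q\<close> serves all generic points simultaneously;
  invariance compares the values at two of them, x and hx + h0.\<close>

lemma mratsE:
  assumes "r \<in> mrats C V" "generic_point C V a"
  obtains p q where "r = Fract p q" "p \<in> mpolys C V" "q \<in> mpolys C V" "q \<noteq> 0"
    "\<And>b. generic_point C V b \<Longrightarrow> mpoly_eval (\<lambda>c. c) b q \<noteq> 0"
    "\<And>b. generic_point C V b \<Longrightarrow>
       mrat_eval (\<lambda>c. c) b r = mpoly_eval (\<lambda>c. c) b p / mpoly_eval (\<lambda>c. c) b q"
proof -
  obtain p q where *: "r = Fract p q" "p \<in> mpolys C V" "q \<in> mpolys C V" "q \<noteq> 0"
    using assms by (auto simp: mrats_def)
  moreover have "mpoly_eval (\<lambda>c. c) b q \<noteq> 0" if "generic_point C V b" for b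
    using * that by (auto simp: generic_point_def)
  ultimately show thesis
    by (intro that[of p q]) (auto simp: mrat_eval_Fract[OF comm_ring_hom_ident])
qed

lemma mrat_eval_quotient:
  assumes "generic_point C V a" "q \<in> mpolys C V" "q \<noteq> 0"
  shows "mrat_eval (\<lambda>c. c) a (Fract p q) = mpoly_eval (\<lambda>c. c) a p / mpoly_eval (\<lambda>c. c) a q"
  using assms by (intro mrat_eval_Fract comm_ring_hom_ident) (auto simp: generic_point_def)

lemma mrat_eval_hom:
  assumes a: "generic_point C V a" and r: "r \<in> mrats C V" and s: "s \<in> mrats C V"
  shows mrat_eval_add: "mrat_eval (\<lambda>c. c) a (r + s) = mrat_eval (\<lambda>c. c) a r + mrat_eval (\<lambda>c. c) a s"
    and mrat_eval_diff: "mrat_eval (\<lambda>c. c) a (r - s) = mrat_eval (\<lambda>c. c) a r - mrat_eval (\<lambda>c. c) a s"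
    and mrat_eval_mult: "mrat_eval (\<lambda>c. c) a (r * s) = mrat_eval (\<lambda>c. c) a r * mrat_eval (\<lambda>c. c) a s"
proof -
  interpret comm_ring_hom "mpoly_eval (\<lambda>c. c) a"
    by (rule comm_ring_hom_mpoly_eval[OF comm_ring_hom_ident])
  note ev = mrat_eval_Fract[OF comm_ring_hom_ident, of a]
  obtain p q where r: "r = Fract p q" "q \<noteq> 0" and q: "mpoly_eval (\<lambda>c. c) a q \<noteq> 0"
    by (rule mratsE[OF r a]) (use a in blast)
  obtain p' q' where s: "s = Fract p' q'" "q' \<noteq> 0" and q': "mpoly_eval (\<lambda>c. c) a q' \<noteq> 0"
    by (rule mratsE[OF s a]) (use a in blast)
  note eqs = r(1) s(1) r(2) s(2) q q'
  show "mrat_eval (\<lambda>c. c) a (r + s) = mrat_eval (\<lambda>c. c) a r + mrat_eval (\<lambda>c. c) a s"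
    by (simp add: eqs ev hom_add hom_mult field_simps)
  show *: "mrat_eval (\<lambda>c. c) a (r - s) = mrat_eval (\<lambda>c. c) a r - mrat_eval (\<lambda>c. c) a s"
    by (simp add: eqs ev hom_minus hom_mult field_simps)
  show "mrat_eval (\<lambda>c. c) a (r * s) = mrat_eval (\<lambda>c. c) a r * mrat_eval (\<lambda>c. c) a s"
    by (simp add: eqs ev hom_mult)
qed

lemma mrat_eval_inverse:
  assumes a: "generic_point C V a" and r: "r \<in> mrats C V"
  shows "mrat_eval (\<lambda>c. c) a (inverse r) = inverse (mrat_eval (\<lambda>c. c) a r)"
proof -
  note ev = mrat_eval_Fract[OF comm_ring_hom_ident, of a]
  obtain p q where r: "r = Fract p q" "p \<in> mpolys C V" "q \<noteq> 0" and q: "mpoly_eval (\<lambda>c. c) a q \<noteq> 0"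
    by (rule mratsE[OF r a]) (use a in blast)
  have p0: "mpoly_eval (\<lambda>c. c) a p \<noteq> 0" if "p \<noteq> 0" 
    using a r(2) that by (auto simp: generic_point_def)
  have "mpoly_eval (\<lambda>c. c) a 1 = 1"
    by (simp flip: single_one add: mpoly_eval_const[OF comm_ring_hom_ident])
  then have zero: "mrat_eval (\<lambda>c. c) a 0 = 0" by (simp add: Zero_fract_def ev mpoly_eval_def)
  show "mrat_eval (\<lambda>c. c) a (inverse r) = inverse (mrat_eval (\<lambda>c. c) a r)"
  proof (cases "p = 0")
    case True
    then show ?thesis using zero by (simp add: r(1) q fract_collapse)
  next
    case False
    then show ?thesis by (simp add: r(1) q ev p0)
  qed
qed

text \<open>A vanishing value forces the numerator to vanish. Hence an element of the field
  generated by a generic point knows its rational function, on which \<open>transl\<close>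
  rests.\<close>

lemma mrat_eval_inj_on:
  assumes C: "is_subfield C" and a: "generic_point C V a"
  shows "inj_on (mrat_eval (\<lambda>c. c) a) (mrats C V)"
proof (rule inj_onI)
  fix r s assume rs: "r \<in> mrats C V" "s \<in> mrats C V" "mrat_eval (\<lambda>c. c) a r = mrat_eval (\<lambda>c. c) a s"
  have "r - s \<in> mrats C V" using rs is_subfieldD(4)[OF is_subfield_mrats[OF C]] by blast
  then obtain p q where *: "r - s = Fract p q" "p \<in> mpolys C V" "mpoly_eval (\<lambda>c. c) a q \<noteq> 0"
    "mrat_eval (\<lambda>c. c) a (r - s) = mpoly_eval (\<lambda>c. c) a p / mpoly_eval (\<lambda>c. c) a q"
    using mratsE[OF _ a] a by metis
  with rs mrat_eval_diff[OF a rs(1,2)] have "p = 0"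
    using a by (auto simp: generic_point_def)
  with *(1) show "r = s" by (simp add: fract_collapse)
qed

lemma mpolys_closed:
  assumes C: "is_subfield C" and "p \<in> mpolys C V" "q \<in> mpolys C V"
  shows mpolys_closed_add: "p + q \<in> mpolys C V" and mpolys_closed_mult: "p * q \<in> mpolys C V"
  using assms(2,3) by (auto intro!: mpolys_add mpolys_mult is_subfieldD[OF C])

section \<open>The affine action on jets\<close>

text \<open>The image of the indeterminate \<open>(j, m)\<close> under both of its readings: as an
  entry of column \<open>m\<close> under the formal action, and as the \<open>m\<close>-th
  derivative of an entry of x when x becomes hx + h0.\<close>

definition affine_lin :: "nat \<Rightarrow> 'a::field mat \<times> 'a vec \<Rightarrow> nat \<times> nat \<Rightarrow> 'a mpoly" where
  "affine_lin n = (\<lambda>(h, h0) (j, m). (\<Sum>k<n. Poly_Mapping.single 0 (h $$ (j, k)) * mpoly_var (k, m)) +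
     Poly_Mapping.single 0 (if m = 0 then h0 $ j else 0))"

definition affine_subst :: "nat \<Rightarrow> 'a::field mat \<times> 'a vec \<Rightarrow> 'a mpoly \<Rightarrow> 'a mpoly" where
  "affine_subst n g = mpoly_eval (Poly_Mapping.single 0) (affine_lin n g)"

text \<open>The substitution mixes rows but keeps the order \<open>m\<close>, so every restriction
  \<open>J\<close> on the orders survives. It is used with all orders and with orders up to
  \<open>n\<close>.\<close>

lemma affine_subst_mem:
  fixes C :: "'a::field set"
  assumes C: "is_subfield C" and g: "g \<in> carrier (affine_group n C)"
    and p: "p \<in> mpolys C ({..<n} \<times> J)"
  shows "affine_subst n g p \<in> mpolys C ({..<n} \<times> J)"
proof -
  obtain h h0 where gh: "g = (h, h0)" by fastforce
  interpret comm_ring_hom "affine_subst n g"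
    unfolding affine_subst_def by (intro comm_ring_hom_mpoly_eval comm_ring_hom_single)
  note C' = is_subfieldD(1,2,3,5)[OF C]
  note m = mpolys_closed_mult[OF C] and a = mpolys_closed_add[OF C]
  from p show ?thesis
  proof (induction rule: mpolys_induct)
    case (const c)
    then show ?case using C'
      by (auto simp: affine_subst_def mpoly_eval_const[OF comm_ring_hom_single] intro!: mpolys_single)
  next
    case (var v)
    then obtain j m where v: "v = (j, m)" "j < n" "m \<in> J" by auto
    have "affine_lin n g (j, m) \<in> mpolys C ({..<n} \<times> J)"
      unfolding affine_lin_def gh case_prod_conv
      using v g gh C' by (intro a mpolys_sum m mpolys_single C') (auto simp: affine_group_def)
    then show ?case
      unfolding v affine_subst_def mpoly_eval_var[OF comm_ring_hom_single] .
  qed (auto simp: hom_add hom_mult intro: a m)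
qed

locale diff_indep =
  fixes d :: "'k::field_char_0 \<Rightarrow> 'k" and C :: "'k set" and n :: nat and x :: "'k vec"
  assumes deriv: "derivation d" and C: "is_subfield C" and d_const: "c \<in> C \<Longrightarrow> d c = 0"
    and x: "x \<in> carrier_vec n" and generic_x: "generic_point C ({..<n} \<times> UNIV) (jet d x)"
begin

abbreviation "V \<equiv> {..<n} \<times> (UNIV :: nat set)"
abbreviation "Vn \<equiv> {..<n} \<times> {..n}"
abbreviation "ev y p \<equiv> mpoly_eval (\<lambda>c. c) (jet d y) p"

definition act :: "'k mat \<times> 'k vec \<Rightarrow> 'k vec \<Rightarrow> 'k vec" where
  "act = (\<lambda>(h, h0) y. h *\<^sub>v y + h0)"

lemmas ev_hom = comm_ring_hom_mpoly_eval[OF comm_ring_hom_ident]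

lemma jet_act:
  assumes g: "g \<in> carrier (affine_group n C)" and y: "y \<in> carrier_vec n" and j: "j < n"
  shows "jet d (act g y) (j, m) = ev y (affine_lin n g (j, m))"
proof -
  obtain h h0 where gh: "g = (h, h0)" by fastforce
  have h: "h \<in> carrier_mat n n" "h0 \<in> carrier_vec n" "\<And>k. k < n \<Longrightarrow> h $$ (j, k) \<in> C" "h0 $ j \<in> C"
    using g gh j by (auto simp: affine_group_def)
  interpret comm_ring_hom "mpoly_eval (\<lambda>c. c) (jet d y)" by (rule ev_hom)
  have "act g y $ j = (\<Sum>k<n. h $$ (j, k) * y $ k) + h0 $ j"
    using h y j by (simp add: act_def gh scalar_prod_def lessThan_atLeast0)
  then have "jet d (act g y) (j, m) =
      (\<Sum>k<n. h $$ (j, k) * (d ^^ m) (y $ k)) + (if m = 0 then h0 $ j else 0)"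
    using derivation_pow_affine[OF deriv, of "{..<n}" "\<lambda>k. h $$ (j, k)" "h0 $ j" m "\<lambda>k. y $ k"]
    by (simp add: jet_def h d_const)
  also have "\<dots> = ev y (affine_lin n g (j, m))"
    by (simp add: affine_lin_def gh hom_add hom_sum hom_mult mpoly_eval_const[OF comm_ring_hom_ident]
        mpoly_eval_var[OF comm_ring_hom_ident, simplified])
      (simp add: jet_def)
  finally show ?thesis .
qed

text \<open>The vector \<open>y\<close> is arbitrary because \<open>affine_subst_eq_0\<close> needs
  the statement at a preimage of \<open>x\<close>, not only at \<open>x\<close>.\<close>

lemma ev_affine_subst:
  assumes g: "g \<in> carrier (affine_group n C)" and y: "y \<in> carrier_vec n" and p: "p \<in> mpolys C V"
  shows "ev y (affine_subst n g p) = ev (act g y) p"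
proof -
  have "ev y (affine_subst n g p) =
      mpoly_eval (\<lambda>c. ev y (Poly_Mapping.single 0 c)) (\<lambda>v. ev y (affine_lin n g v)) p"
    unfolding affine_subst_def by (rule hom_mpoly_eval[OF ev_hom])
  also have "\<dots> = mpoly_eval (\<lambda>c. c) (\<lambda>v. ev y (affine_lin n g v)) p"
    by (simp add: mpoly_eval_const[OF comm_ring_hom_ident])
  also have "\<dots> = ev (act g y) p"
    by (rule mpoly_eval_cong[OF p]) (auto simp: jet_act[OF g y])
  finally show ?thesis .
qed

lemma act_mem: "g \<in> carrier (affine_group n C) \<Longrightarrow> y \<in> carrier_vec n \<Longrightarrow> act g y \<in> carrier_vec n"
  by (auto simp: affine_group_def act_def)

lemma act_surj:
  assumes g: "g \<in> carrier (affine_group n C)"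
  shows "\<exists>y \<in> carrier_vec n. act g y = x"
proof -
  interpret group "affine_group n C" by (rule group_affine_group[OF C])
  define g' where "g' = inv\<^bsub>affine_group n C\<^esub> g"
  have g': "g' \<in> carrier (affine_group n C)" using g by (simp add: g'_def)
  have gg': "g \<otimes>\<^bsub>affine_group n C\<^esub> g' = \<one>\<^bsub>affine_group n C\<^esub>"
    using g by (simp add: g'_def)
  obtain h h0 k k0 where eq: "g = (h, h0)" "g' = (k, k0)" by fastforce
  have h: "h \<in> carrier_mat n n" "h0 \<in> carrier_vec n" "k \<in> carrier_mat n n" "k0 \<in> carrier_vec n"
    using g g' eq by (auto simp: affine_group_def)
  have 1: "h * k = 1\<^sub>m n" "h *\<^sub>v k0 + h0 = 0\<^sub>v n"
    using gg' unfolding eq by (auto simp: affine_group_def)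
  have "act g (act g' x) = h *\<^sub>v (k *\<^sub>v x + k0) + h0" by (simp add: act_def eq)
  also have "h *\<^sub>v (k *\<^sub>v x + k0) = h *\<^sub>v (k *\<^sub>v x) + h *\<^sub>v k0"
    by (rule mult_add_distrib_mat_vec[of _ n n]) (use h x in auto)
  also have "h *\<^sub>v (k *\<^sub>v x) = x"
    using assoc_mult_mat_vec[OF h(1,3) x] x by (simp add: 1)
  also have "x + h *\<^sub>v k0 + h0 = x + (h *\<^sub>v k0 + h0)"
    by (rule assoc_add_vec[of _ n]) (use h x in auto)
  also have "\<dots> = x" using x by (simp add: 1)
  finally show ?thesis using act_mem[OF g' x] by blast
qed

text \<open>Evaluating at a preimage \<open>y\<close> of \<open>x\<close> under the affine map shows
  that \<open>p\<close> vanishes at \<open>x\<close>, which is generic. The substitution itself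
  never has to be inverted on polynomials.\<close>

lemma affine_subst_eq_0:
  assumes g: "g \<in> carrier (affine_group n C)" and p: "p \<in> mpolys C V" and 0: "affine_subst n g p = 0"
  shows "p = 0"
proof -
  obtain y where y: "y \<in> carrier_vec n" "act g y = x" using act_surj[OF g] by blast
  have "ev x p = 0" using ev_affine_subst[OF g y(1) p] by (simp add: 0 y(2) mpoly_eval_def)
  then show ?thesis using generic_x p by (auto simp: generic_point_def)
qed

lemma ev_x_inj:
  assumes "p \<in> mpolys C V" "q \<in> mpolys C V" "ev x p = ev x q"
  shows "p = q"
proof -
  interpret comm_ring_hom "mpoly_eval (\<lambda>c. c) (jet d x)" by (rule ev_hom)
  have "Poly_Mapping.single 0 (-1) \<in> mpolys C V"
    using is_subfieldD(1,2)[OF C] is_subfieldD(8)[OF C, of 1] by (intro mpolys_single) auto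
  then have "p + Poly_Mapping.single 0 (-1) * q \<in> mpolys C V"
    using assms is_subfieldD[OF C] by (intro mpolys_add mpolys_mult) auto
  moreover have "p + Poly_Mapping.single 0 (-1) * q = p - q" by (simp add: single_uminus single_one)
  ultimately have "p - q \<in> mpolys C V" by simp
  moreover have "ev x (p - q) = 0" using assms by (simp add: hom_minus)
  ultimately have "p - q = 0" using generic_x unfolding generic_point_def by blast
  then show ?thesis by simp
qed

text \<open>This gives f(hx + h0) a meaning for every f: no denominator vanishes there. A polynomial
  relation at hx + h0 pulls back to one at x, and the substitution is injective.\<close>

lemma generic_act:
  assumes g: "g \<in> carrier (affine_group n C)"
  shows "generic_point C V (jet d (act g x))"
  unfolding generic_point_def
proof (intro ballI impI)
  fix p assume p: "p \<in> mpolys C V" and "ev (act g x) p = 0"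
  then have "ev x (affine_subst n g p) = 0" using ev_affine_subst[OF g x] by simp
  then have "affine_subst n g p = 0"
    using generic_x affine_subst_mem[OF C g p] by (auto simp: generic_point_def)
  then show "p = 0" by (rule affine_subst_eq_0[OF g p])
qed

section \<open>The formal action on columns compared with the action on values\<close>

lemma zcol_act_eq:
  assumes "j < n" "g \<in> carrier (affine_group n C)"
  shows "zcol_act n g m $ j = Fract (affine_lin n g (j, m)) 1"
proof -
  obtain h h0 where gh: "g = (h, h0)" by fastforce
  have h: "h \<in> carrier_mat n n" "h0 \<in> carrier_vec n" using assms gh by (auto simp: affine_group_def)
  interpret comm_ring_hom "\<lambda>p::'k mpoly. Fract p 1" by (rule comm_ring_hom_Fract)
  have "zcol_act n g m $ j =
      (\<Sum>k<n. rconst (h $$ (j, k)) * rvar (k, m)) + (if m = 0 then rconst (h0 $ j) else 0)"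
    using h assms(1) by (auto simp: zcol_act_def gh zcol_def scalar_prod_def lessThan_atLeast0)
  also have "\<dots> = Fract (affine_lin n g (j, m)) 1"
    by (simp add: affine_lin_def gh hom_add hom_sum hom_mult rconst_def rvar_def del: mult_fract add_fract)
  finally show ?thesis .
qed

lemma mrat_eval_zcol_act:
  assumes g: "g \<in> carrier (affine_group n C)" and "p \<in> mpolys C V" "q \<in> mpolys C V" "q \<noteq> 0"
  shows "mrat_eval rconst (\<lambda>(j, m). zcol_act n g m $ j) (Fract p q) =
    Fract (affine_subst n g p) (affine_subst n g q)"
proof -
  have *: "mpoly_eval rconst (\<lambda>(j, m). zcol_act n g m $ j) p = Fract (affine_subst n g p) 1"
    if "p \<in> mpolys C V" for p
  proof -
    have "mpoly_eval rconst (\<lambda>(j, m). zcol_act n g m $ j) p =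
        mpoly_eval rconst (\<lambda>v. Fract (affine_lin n g v) 1) p"
      by (rule mpoly_eval_cong[OF that]) (auto simp: zcol_act_eq g)
    also have "\<dots> = Fract (affine_subst n g p) 1"
      unfolding affine_subst_def by (subst hom_mpoly_eval[OF comm_ring_hom_Fract]) (simp add: rconst_def[abs_def])
    finally show ?thesis .
  qed
  have "affine_subst n g q \<noteq> 0" using affine_subst_eq_0[OF g] assms(3,4) by blast
  then have "mpoly_eval rconst (\<lambda>(j, m). zcol_act n g m $ j) q \<noteq> 0"
    by (simp add: *[OF assms(3)] Zero_fract_def eq_fract)
  from mrat_eval_Fract[OF comm_ring_hom_rconst this] show ?thesis
    using assms(2,3) by (simp add: *)
qed

text \<open>After clearing denominators both sides are the same polynomial identity, formal on the
  left and evaluated at \<open>x\<close> on the right; over \<open>C\<close> an identity may be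
  tested at the generic point \<open>x\<close>.\<close>

lemma invariant_iff:
  assumes g: "g \<in> carrier (affine_group n C)" and r: "r \<in> mrats C V"
  shows "mrat_eval rconst (\<lambda>(j, m). zcol_act n g m $ j) r = r \<longleftrightarrow>
    diff_rat_eval d r (act g x) = diff_rat_eval d r x"
proof -
  interpret comm_ring_hom "mpoly_eval (\<lambda>c. c) (jet d x)" by (rule ev_hom)
  from mratsE[OF r generic_x] obtain p q where r: "r = Fract p q" "p \<in> mpolys C V" "q \<in> mpolys C V" "q \<noteq> 0"
    and e: "\<And>b. generic_point C V b \<Longrightarrow> mpoly_eval (\<lambda>c. c) b q \<noteq> 0"
    "\<And>b. generic_point C V b \<Longrightarrow>
       mrat_eval (\<lambda>c. c) b r = mpoly_eval (\<lambda>c. c) b p / mpoly_eval (\<lambda>c. c) b q"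
    by metis
  note m = mpolys_closed_mult[OF C]
  note s = affine_subst_mem[OF C g r(2)] affine_subst_mem[OF C g r(3)]
  have "affine_subst n g q \<noteq> 0" using affine_subst_eq_0[OF g r(3)] r(4) by blast
  then have "mrat_eval rconst (\<lambda>(j, m). zcol_act n g m $ j) r = r \<longleftrightarrow>
      affine_subst n g p * q = p * affine_subst n g q"
    using r(4) by (simp add: r(1) mrat_eval_zcol_act[OF g r(2,3,4)] eq_fract)
  also have "\<dots> \<longleftrightarrow> ev x (affine_subst n g p * q) = ev x (p * affine_subst n g q)"
    using ev_x_inj[OF m[OF s(1) r(3)] m[OF r(2) s(2)]] by auto
  also have "\<dots> \<longleftrightarrow> ev (act g x) p * ev x q = ev x p * ev (act g x) q"
    by (simp add: hom_mult ev_affine_subst[OF g x] r)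
  also have "\<dots> \<longleftrightarrow> diff_rat_eval d r (act g x) = diff_rat_eval d r x"
    using e(1)[OF generic_x] e(1)[OF generic_act[OF g]]
    by (simp add: e(2)[OF generic_x] e(2)[OF generic_act[OF g]] frac_eq_eq)
  finally show ?thesis .
qed

text \<open>The witness must not depend on \<open>y\<close>: the same \<open>p'\<close> then
  represents the derivative at x and at hx + h0, which is why invariance survives
  differentiation.\<close>

lemma mpoly_derivative:
  assumes "p \<in> mpolys C V"
  shows "\<exists>p'\<in>mpolys C V. \<forall>y. ev y p' = d (ev y p)"
proof -
  note C' = is_subfieldD(1,2,3,5)[OF C]
  note m = mpolys_closed_mult[OF C] and a = mpolys_closed_add[OF C]
  have hom: "ev y (p + q) = ev y p + ev y q" "ev y (p * q) = ev y p * ev y q" for y p q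
    by (auto simp: mpoly_eval_add[OF comm_ring_hom_ident] mpoly_eval_mult[OF comm_ring_hom_ident])
  \<comment> \<open>Membership of \<open>p\<close> is carried along because the product rule
    \<open>p' * q + p * q'\<close> involves the factors themselves.\<close>
  from assms have "p \<in> mpolys C V \<and> (\<exists>p'\<in>mpolys C V. \<forall>y. ev y p' = d (ev y p))"
  proof (induction rule: mpolys_induct)
    case (const c)
    then have c: "c \<in> C" using C' by auto
    have "\<forall>y. ev y 0 = d (ev y (Poly_Mapping.single 0 c))"
      by (simp add: mpoly_eval_const[OF comm_ring_hom_ident] d_const[OF c]) (simp add: mpoly_eval_def)
    then have "\<exists>p'\<in>mpolys C V. \<forall>y. ev y p' = d (ev y (Poly_Mapping.single 0 c))"
      by (rule bexI) (rule mpolys_zero[OF C'(1)])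
    moreover have "Poly_Mapping.single 0 c \<in> mpolys C V"
      using c C' by (intro mpolys_single) auto
    ultimately show ?case by blast
  next
    case (var v)
    obtain j m where v: "v = (j, m)" by fastforce
    have "mpoly_var (j, i) \<in> mpolys C V" for i
      using var C' by (intro mpolys_single) (auto simp: v)
    moreover have "ev y (mpoly_var (j, Suc m)) = d (ev y (mpoly_var (j, m)))" for y
      by (simp add: mpoly_eval_var[OF comm_ring_hom_ident, simplified] jet_def)
    ultimately show ?case unfolding v by blast
  next
    case (add p q)
    then obtain p' q' where "p' \<in> mpolys C V" "q' \<in> mpolys C V"
      "\<forall>y. ev y p' = d (ev y p)" "\<forall>y. ev y q' = d (ev y q)" by blast
    with add show ?case
      by (intro conjI bexI[of _ "p' + q'"] allI) (simp_all add: hom derivation_add[OF deriv] a)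
  next
    case (mult p q)
    then obtain p' q' where "p' \<in> mpolys C V" "q' \<in> mpolys C V"
      "\<forall>y. ev y p' = d (ev y p)" "\<forall>y. ev y q' = d (ev y q)" by blast
    with mult show ?case
      by (intro conjI bexI[of _ "p' * q + p * q'"] allI) (simp_all add: hom derivation_mult[OF deriv] a m)
  qed
  then show ?thesis by blast
qed

lemma mrat_derivative:
  assumes r: "r \<in> mrats C V"
  shows "\<exists>r'\<in>mrats C V. \<forall>y. generic_point C V (jet d y) \<longrightarrow> diff_rat_eval d r' y = d (diff_rat_eval d r y)"
proof -
  from mratsE[OF r generic_x] obtain p q where r: "r = Fract p q" "p \<in> mpolys C V" "q \<in> mpolys C V" "q \<noteq> 0"
    and e: "\<And>b. generic_point C V b \<Longrightarrow> mpoly_eval (\<lambda>c. c) b q \<noteq> 0"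
    "\<And>b. generic_point C V b \<Longrightarrow>
       mrat_eval (\<lambda>c. c) b r = mpoly_eval (\<lambda>c. c) b p / mpoly_eval (\<lambda>c. c) b q"
    by metis
  obtain p' q' where pq': "p' \<in> mpolys C V" "q' \<in> mpolys C V"
    "\<And>y. ev y p' = d (ev y p)" "\<And>y. ev y q' = d (ev y q)"
    using mpoly_derivative r(2,3) by metis
  have frac: "Fract a b \<in> mrats C V" if "a \<in> mpolys C V" "b \<in> mpolys C V" "b \<noteq> 0" for a b
    using that unfolding mrats_def by blast
  note m = mpolys_closed_mult[OF C]
  have mem: "Fract (p' * q) (q * q) \<in> mrats C V" "Fract (p * q') (q * q) \<in> mrats C V"
    using r pq' by (auto intro!: frac m)
  have "diff_rat_eval d (Fract (p' * q) (q * q) - Fract (p * q') (q * q)) y = d (diff_rat_eval d r y)"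
    if y: "generic_point C V (jet d y)" for y
    using e(1)[OF y] r(4)
    by (simp add: mrat_eval_diff[OF y mem] mrat_eval_quotient[OF y m[OF r(3,3)]] e(2)[OF y]
        mpoly_eval_mult[OF comm_ring_hom_ident] pq' derivation_divide[OF deriv] diff_divide_distrib
        del: diff_fract)
  moreover have "Fract (p' * q) (q * q) - Fract (p * q') (q * q) \<in> mrats C V"
    using is_subfieldD(4)[OF is_subfield_mrats[OF C]] mem by blast
  ultimately show ?thesis by blast
qed

end

section \<open>Wronskians\<close>

lemma mpolys_prod:
  assumes "is_subfield C" "\<And>i. i \<in> I \<Longrightarrow> p i \<in> mpolys C V"
  shows "prod p I \<in> mpolys C V"
  using assms(2)
  by (induction I rule: infinite_finite_induct)
    (auto intro: mpolys_one mpolys_closed_mult[OF assms(1)] is_subfieldD[OF assms(1)])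

lemma mpolys_det:
  assumes C: "is_subfield C" and A: "A \<in> carrier_mat n n"
    and "\<And>i j. i < n \<Longrightarrow> j < n \<Longrightarrow> A $$ (i, j) \<in> mpolys C V"
  shows "det A \<in> mpolys C V"
proof -
  have "signof p \<in> mpolys C V" for p :: "nat \<Rightarrow> nat"
  proof -
    have "Poly_Mapping.single 0 (-1) \<in> mpolys C V"
      using is_subfieldD(1,2)[OF C] is_subfieldD(8)[OF C, of 1] by (intro mpolys_single) auto
    then have "- 1 \<in> mpolys C V" by (simp add: single_uminus single_one)
    then show ?thesis using mpolys_one is_subfieldD(1,2)[OF C] by (auto simp: sign_def)
  qed
  moreover have "p i < n" if "p permutes {0..<n}" "i < n" for p i
    using that permutes_in_image[of p "{0..<n}" i] by auto
  ultimately show ?thesis unfolding det_def'[OF A]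
    by (intro mpolys_sum mpolys_closed_mult[OF C] mpolys_prod[OF C] is_subfieldD[OF C] assms(3)) auto
qed

text \<open>A common form of both Wronskians: \<open>ms\<close> lists the orders of the columns, 1
  to n for \<open>wronskian\<close>, and 1 to n + 1 without \<open>i\<close> for
  \<open>wronskian_del\<close>.\<close>

definition jet_det :: "('a::field \<Rightarrow> 'a) \<Rightarrow> nat \<Rightarrow> nat list \<Rightarrow> 'a vec \<Rightarrow> 'a" where
  "jet_det d n ms y = det (mat_of_cols n (map (\<lambda>m. map_vec (d ^^ m) y) ms))"

lemma wronskian_eq_jet_det: "wronskian d n y = jet_det d n [1..<n+1] y"
  by (simp add: wronskian_def jet_det_def)

lemma wronskian_del_eq_jet_det: "wronskian_del d n i y = jet_det d n (filter (\<lambda>m. m \<noteq> i) [1..<n+2]) y"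
proof -
  \<comment> \<open>The guarded list comprehension in \<open>wronskian_del\<close> is parsed as this
    \<open>concat\<close>.\<close>
  have "concat (map (\<lambda>m. if m \<noteq> i then [f m] else []) ms) = map f (filter (\<lambda>m. m \<noteq> i) ms)"
    for f :: "nat \<Rightarrow> 'a vec" and ms by (induction ms) auto
  then show ?thesis unfolding wronskian_del_def jet_det_def by (simp only:)
qed

lemma filter_upt_neq:
  assumes "a \<le> i" "i < b"
  shows "filter (\<lambda>m. m \<noteq> i) [a..<b] = [a..<i] @ [Suc i..<b]"
proof -
  have "[a..<b] = [a..<i] @ [i..<b]" using assms upt_add_eq_append[of a i "b - i"] by simp
  also have "[i..<b] = i # [Suc i..<b]" using assms by (simp add: upt_conv_Cons)
  finally show ?thesis by (simp add: filter_id_conv)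
qed

text \<open>Cramer's rule without division, so that no Wronskian has to be nonzero here. The signs
  are hidden because later only their membership in every subfield matters.\<close>

lemma wronskian_cramer:
  fixes d :: "'a::field \<Rightarrow> 'a"
  assumes y: "y \<in> carrier_vec n" and j: "j < n"
  shows "\<exists>\<epsilon>. (\<forall>i. \<epsilon> i \<in> {1, -1}) \<and>
    wronskian d n y * (d ^^ Suc n) (y $ j) = (\<Sum>i\<in>{1..n}. \<epsilon> i * wronskian_del d n i y * (d ^^ i) (y $ j))"
proof -
  \<comment> \<open>The rows \<open>y\<^sub>j, y\<^sub>0, \<dots>, y\<^sub>n\<^sub>-\<^sub>1\<close> of derivatives are dependent: expand along the first.\<close>
  define B where "B = mat (Suc n) (Suc n) (\<lambda>(r, c). (d ^^ Suc c) (y $ (if r = 0 then j else r - 1)))"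
  have B: "B \<in> carrier_mat (Suc n) (Suc n)" by (simp add: B_def)
  have "row B 0 = row B (Suc j)" using j by (auto simp: B_def)
  then have "det B = 0" using j by (intro det_identical_rows[OF B, of 0 "Suc j"]) auto
  \<comment> \<open>Columns are counted from 0 and column \<open>c\<close> holds order
    \<open>c + 1\<close>, so deleting it omits the order \<open>Suc c\<close>.\<close>
  moreover have "mat_delete B 0 c =
      mat_of_cols n (map (\<lambda>m. map_vec (d ^^ m) y) (filter (\<lambda>m. m \<noteq> Suc c) [1..<n+2]))"
    if "c < Suc n" for c
    using that y
    by (auto simp: filter_upt_neq mat_delete_def B_def mat_of_cols_index nth_append simp del: upt_Suc
        intro!: eq_matI)
  then have "cofactor B 0 c = (-1) ^ c * wronskian_del d n (Suc c) y" if "c < Suc n" for c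
    using that by (simp add: cofactor_def wronskian_del_eq_jet_det jet_det_def)
  then have "det B = (\<Sum>c<Suc n. (d ^^ Suc c) (y $ j) * ((-1) ^ c * wronskian_del d n (Suc c) y))"
    unfolding laplace_expansion_row[OF B zero_less_Suc] by (intro sum.cong) (auto simp: B_def)
  \<comment> \<open>The last term of the expansion omits the order n + 1 and so carries the
    Wronskian itself; it is the term to be isolated.\<close>
  moreover have "wronskian_del d n (Suc n) y = wronskian d n y"
    by (simp add: wronskian_del_eq_jet_det wronskian_eq_jet_det filter_upt_neq)
  ultimately have *: "(-1) ^ n * (wronskian d n y * (d ^^ Suc n) (y $ j)) =
      - (\<Sum>c<n. (-1) ^ c * wronskian_del d n (Suc c) y * (d ^^ Suc c) (y $ j))"
    by (simp add: ac_simps add_eq_0_iff)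
  have "wronskian d n y * (d ^^ Suc n) (y $ j) =
      (-1) ^ n * ((-1) ^ n * (wronskian d n y * (d ^^ Suc n) (y $ j)))"
    by (simp add: mult.assoc[symmetric] power_mult_distrib[symmetric])
  also have "\<dots> = (\<Sum>c<n. (-1) ^ Suc (n + c) * wronskian_del d n (Suc c) y * (d ^^ Suc c) (y $ j))"
    unfolding * by (simp add: sum_distrib_left power_add sum_negf mult.assoc)
  also have "\<dots> = (\<Sum>i\<in>{1..n}. (-1) ^ (n + i) * wronskian_del d n i y * (d ^^ i) (y $ j))"
    by (rule sum.reindex_bij_witness[of _ "\<lambda>i. i - 1" Suc]) auto
  finally show ?thesis
    by (intro exI[of _ "\<lambda>i. (-1) ^ (n + i)"]) (auto simp: minus_one_power_iff)
qed

section \<open>Jet determinants under the affine group, and reduction of high derivatives\<close>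

context diff_indep
begin

text \<open>Excluding order 0 removes the translation, so every column is multiplied by
  \<open>h\<close>. The factor \<open>det h\<close> does not depend on the orders and cancels in
  quotients.\<close>

lemma jet_det_act:
  assumes g: "(h, h0) \<in> carrier (affine_group n C)" and y: "y \<in> carrier_vec n"
    and ms: "0 \<notin> set ms" "length ms = n"
  shows "jet_det d n ms (act (h, h0) y) = det h * jet_det d n ms y"
proof -
  have h: "h \<in> carrier_mat n n" "h0 \<in> carrier_vec n" "\<And>j k. j < n \<Longrightarrow> k < n \<Longrightarrow> h $$ (j, k) \<in> C"
    "\<And>j. j < n \<Longrightarrow> h0 $ j \<in> C"
    using g by (auto simp: affine_group_def)
  have "mat_of_cols n (map (\<lambda>m. map_vec (d ^^ m) (act (h, h0) y)) ms) =
      h * mat_of_cols n (map (\<lambda>m. map_vec (d ^^ m) y) ms)" (is "?A = h * ?B")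
  proof (rule eq_matI)
    fix j i assume "j < dim_row (h * ?B)" "i < dim_col (h * ?B)"
    then have ji: "j < n" "i < n" using h ms by auto
    have "ms ! i \<noteq> 0" using ms ji by (metis nth_mem)
    have "?A $$ (j, i) = (d ^^ (ms ! i)) ((\<Sum>k<n. h $$ (j, k) * y $ k) + h0 $ j)"
      using h y ji ms by (simp add: mat_of_cols_index act_def scalar_prod_def lessThan_atLeast0)
    also have "\<dots> = (\<Sum>k<n. h $$ (j, k) * (d ^^ (ms ! i)) (y $ k))"
      using derivation_pow_affine[OF deriv, of "{..<n}" "\<lambda>k. h $$ (j, k)" "h0 $ j" "ms ! i" "\<lambda>k. y $ k"]
        h ji \<open>ms ! i \<noteq> 0\<close> by (simp add: d_const)
    also have "\<dots> = (h * ?B) $$ (j, i)"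
      using h y ji ms by (simp add: mat_of_cols_index scalar_prod_def lessThan_atLeast0)
    finally show "?A $$ (j, i) = (h * ?B) $$ (j, i)" .
  qed (use h ms in auto)
  moreover have "?B \<in> carrier_mat n n" using ms by (intro carrier_matI) auto
  ultimately show ?thesis
    unfolding jet_det_def by (simp add: det_mult[OF h(1)])
qed

definition jet_det_poly :: "nat list \<Rightarrow> 'k mpoly" where
  "jet_det_poly ms = det (mat n n (\<lambda>(j, i). mpoly_var (j, ms ! i)))"

lemma jet_det_poly_mem: "jet_det_poly ms \<in> mpolys C V"
  unfolding jet_det_poly_def
  by (rule mpolys_det[OF C, of _ n]) (auto intro!: mpolys_single is_subfieldD[OF C])

lemma eval_jet_det_poly:
  "mpoly_eval (\<lambda>c. c) a (jet_det_poly ms) = det (mat n n (\<lambda>(j, i). a (j, ms ! i)))"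
proof -
  interpret comm_ring_hom "mpoly_eval (\<lambda>c. c) a" by (rule ev_hom)
  have "map_mat (mpoly_eval (\<lambda>c. c) a) (mat n n (\<lambda>(j, i). mpoly_var (j, ms ! i))) =
      mat n n (\<lambda>(j, i). a (j, ms ! i))"
    by (rule eq_matI) (auto simp: mpoly_eval_var[OF comm_ring_hom_ident, simplified])
  then show ?thesis by (simp add: jet_det_poly_def hom_det[symmetric])
qed

lemma ev_jet_det_poly:
  assumes "y \<in> carrier_vec n" "length ms = n"
  shows "ev y (jet_det_poly ms) = jet_det d n ms y"
  unfolding eval_jet_det_poly jet_det_def
  using assms by (intro arg_cong[of _ _ det] eq_matI) (auto simp: mat_of_cols_index jet_def)

text \<open>Setting the indeterminate \<open>(j, m)\<close> to 1 for \<open>m = Suc j\<close> and to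
  0 otherwise turns the matrix into the identity. This point need not be the jet of any vector,
  since a polynomial is being tested.\<close>

lemma wronskian_poly_nonzero: "jet_det_poly [1..<n+1] \<noteq> 0"
proof
  assume 0: "jet_det_poly [1..<n+1] = 0"
  have "mat n n (\<lambda>(j, i). if [1..<n+1] ! i = Suc j then 1 else 0 :: 'k) = 1\<^sub>m n"
    by (rule eq_matI) (auto simp del: upt_Suc)
  then have "mpoly_eval (\<lambda>c. c) (\<lambda>(j, m). if m = Suc j then 1 else 0 :: 'k) (jet_det_poly [1..<n+1]) = 1"
    by (simp add: eval_jet_det_poly del: upt_Suc)
  then show False unfolding 0 by (simp add: mpoly_eval_def)
qed

lemma wronskian_nonzero: "wronskian d n x \<noteq> 0"
  using wronskian_poly_nonzero jet_det_poly_mem generic_x ev_jet_det_poly[OF x, of "[1..<n+1]"]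
  unfolding generic_point_def wronskian_eq_jet_det by (auto simp del: upt_Suc)

text \<open>The span of the orders 1 to n is closed under \<open>d\<close>: the only new derivative,
  of order n + 1, is brought back by \<open>wronskian_cramer\<close>. That relation does not involve
  order 0, which therefore joins only at the end.\<close>

lemma d_iterate_mem_lspan:
  assumes L: "is_diff_subfield d L" and W: "\<And>i. i \<in> {1..n} \<Longrightarrow> wronskian_del d n i x / wronskian d n x \<in> L"
    and j: "j < n"
  shows "(d ^^ m) (x $ j) \<in> lspan L ((\<lambda>i. (d ^^ i) (x $ j)) ` {..n})"
proof -
  have Lf: "is_subfield L" and Ld: "\<And>a. a \<in> L \<Longrightarrow> d a \<in> L" using L by (auto simp: is_diff_subfield_def)
  note Lm = is_subfieldD(5)[OF Lf]
  define B where "B = (\<lambda>i. (d ^^ i) (x $ j)) ` {1..n}"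
  have base: "(d ^^ i) (x $ j) \<in> lspan L B" if "i \<in> {1..n}" for i
    using lspan.scale[OF is_subfieldD(2)[OF Lf], of "(d ^^ i) (x $ j)" B] that by (auto simp: B_def)
  have "0 \<in> lspan L B"
    \<comment> \<open>Zero is taken as 0 times the first derivative; order 1 is available because
      \<open>j < n\<close> makes \<open>n\<close> positive.\<close>
    using lspan_scale[OF Lm is_subfieldD(1)[OF Lf] base[of 1]] j by simp
  obtain \<epsilon> :: "nat \<Rightarrow> 'k" where eps: "\<forall>i. \<epsilon> i \<in> {1, -1}" and cramer: "wronskian d n x * (d ^^ Suc n) (x $ j) =
      (\<Sum>i\<in>{1..n}. \<epsilon> i * wronskian_del d n i x * (d ^^ i) (x $ j))"
    using wronskian_cramer[OF x j] by blast
  have epsL: "\<epsilon> i \<in> L" for i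
  proof -
    have "\<epsilon> i = 1 \<or> \<epsilon> i = - 1" using eps by blast
    then show ?thesis using is_subfieldD(2)[OF Lf] is_subfieldD(8)[OF Lf, of 1] by auto
  qed
  have "(d ^^ Suc n) (x $ j) =
      (\<Sum>i\<in>{1..n}. (\<epsilon> i * (wronskian_del d n i x / wronskian d n x)) * (d ^^ i) (x $ j))"
    using cramer wronskian_nonzero
    by (simp add: nonzero_eq_divide_eq[symmetric] mult.commute[of "wronskian d n x"] sum_divide_distrib
        del: funpow.simps)
  also have "\<dots> \<in> lspan L B"
    by (intro lspan_sum lspan_scale Lm epsL W base \<open>0 \<in> lspan L B\<close>)
  finally have top: "(d ^^ Suc n) (x $ j) \<in> lspan L B" .
  have closed: "d a \<in> lspan L B" if "a \<in> lspan L B" for a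
    using that
  proof (induction rule: lspan.induct)
    case (scale l b)
    then obtain i where i: "i \<in> {1..n}" "b = (d ^^ i) (x $ j)" by (auto simp: B_def)
    have "d b \<in> lspan L B"
    proof (cases "i = n")
      case False
      then show ?thesis using base[of "Suc i"] i by auto
    qed (use top i in auto)
    then show ?case unfolding derivation_mult[OF deriv]
      using scale Ld by (intro lspan.add lspan_scale Lm lspan.scale) auto
  qed (auto simp: derivation_add[OF deriv] intro: lspan.add)
  have "(d ^^ Suc m) (x $ j) \<in> lspan L B" for m
  proof (induction m)
    case 0
    then show ?case using base[of 1] j by simp
  qed (auto dest: closed)
  then have "(d ^^ Suc m) (x $ j) \<in> lspan L ((\<lambda>i. (d ^^ i) (x $ j)) ` {..n})" for m
    by (rule lspan_mono) (auto simp: B_def)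
  moreover have "x $ j \<in> lspan L ((\<lambda>i. (d ^^ i) (x $ j)) ` {..n})"
    using lspan.scale[OF is_subfieldD(2)[OF Lf] imageI[of 0 "{..n}" "\<lambda>i. (d ^^ i) (x $ j)"]] by simp
  ultimately show ?thesis by (cases m) auto
qed

section \<open>The invariant differential field\<close>

abbreviation "evx r \<equiv> diff_rat_eval d r x"

lemma ev_one: "mpoly_eval (\<lambda>c. c) a 1 = 1"
  by (simp flip: single_one add: mpoly_eval_const[OF comm_ring_hom_ident])

lemma ev_zero: "mpoly_eval (\<lambda>c. c) a 0 = 0"
  by (simp add: mpoly_eval_def)

lemma mrat_eval_0_1:
  "mrat_eval (\<lambda>c. c) a 0 = 0" "mrat_eval (\<lambda>c. c) a 1 = 1"
  by (simp_all add: One_fract_def Zero_fract_def mrat_eval_Fract[OF comm_ring_hom_ident] ev_one ev_zero)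

text \<open>Elements of C<x,d> are values, so the rational function is first recovered by inverting
  the evaluation at \<open>x\<close> and then evaluated at hx + h0. Outside C<x,d> the result is
  arbitrary.\<close>

definition transl :: "'k mat \<times> 'k vec \<Rightarrow> 'k \<Rightarrow> 'k" where
  "transl g e = diff_rat_eval d (inv_into (mrats C V) (\<lambda>r. evx r) e) (act g x)"

lemma transl_evx: "r \<in> mrats C V \<Longrightarrow> transl g (evx r) = diff_rat_eval d r (act g x)"
  unfolding transl_def by (subst inv_into_f_f[OF mrat_eval_inj_on[OF C generic_x]]) auto

text \<open>\<open>W = V\<close> gives the field E, and \<open>W = Vn\<close> gives its subfield M
  of functions of order at most \<open>n\<close>.\<close>

lemma is_subfield_evx:
  assumes "W \<subseteq> V"
  shows "is_subfield ((\<lambda>r. evx r) ` mrats C W)"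
proof -
  note R = is_subfieldD[OF is_subfield_mrats[OF C, of W]]
  have sub: "mrats C W \<subseteq> mrats C V" by (rule mrats_mono[OF order.refl assms])
  have "0 \<in> (\<lambda>r. evx r) ` mrats C W" "1 \<in> (\<lambda>r. evx r) ` mrats C W"
    using R(1,2) mrat_eval_0_1[of "jet d x"] by (metis imageI)+
  moreover have "evx r + evx s \<in> (\<lambda>r. evx r) ` mrats C W"
    "evx r - evx s \<in> (\<lambda>r. evx r) ` mrats C W" "evx r * evx s \<in> (\<lambda>r. evx r) ` mrats C W"
    if rs: "r \<in> mrats C W" "s \<in> mrats C W" for r s
  proof -
    have "r \<in> mrats C V" "s \<in> mrats C V" using rs sub by auto
    note hom = mrat_eval_hom[OF generic_x this]
    show "evx r + evx s \<in> (\<lambda>r. evx r) ` mrats C W" "evx r - evx s \<in> (\<lambda>r. evx r) ` mrats C W"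
      "evx r * evx s \<in> (\<lambda>r. evx r) ` mrats C W"
      unfolding hom(1-3)[symmetric] by (intro imageI R rs)+
  qed
  moreover have "inverse (evx r) \<in> (\<lambda>r. evx r) ` mrats C W" if r: "r \<in> mrats C W" for r
  proof -
    have "r \<in> mrats C V" using r sub by auto
    from mrat_eval_inverse[OF generic_x this] show ?thesis
      using imageI[OF R(6)[OF r], of "\<lambda>r. evx r"] by simp
  qed
  ultimately show ?thesis unfolding is_subfield_def by blast
qed

lemma evx_const:
  assumes "c \<in> C"
  shows "rconst c \<in> mrats C W" "evx (rconst c) = c"
proof -
  have "Poly_Mapping.single 0 c \<in> mpolys C W" "1 \<in> mpolys C W"
    using assms by (auto intro!: mpolys_single mpolys_one is_subfieldD[OF C])
  then show "rconst c \<in> mrats C W" unfolding rconst_def mrats_def by fastforce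
  show "evx (rconst c) = c"
    by (simp add: rconst_def mrat_eval_Fract[OF comm_ring_hom_ident]
        mpoly_eval_const[OF comm_ring_hom_ident] ev_one)
qed

text \<open>Evaluation at the generic point hx + h0 is a homomorphism, hence so is
  \<open>transl\<close>. It keeps M because numerator and denominator can be substituted separately,
  and \<open>affine_subst\<close> does not raise the order.\<close>

lemma field_homs_transl:
  assumes H: "H \<subseteq> carrier (affine_group n C)"
  shows "field_homs ((\<lambda>r. evx r) ` mrats C V) ((\<lambda>r. evx r) ` mrats C Vn) (transl ` H)"
proof
  have sub: "mrats C Vn \<subseteq> mrats C V" by (rule mrats_mono) auto
  show "is_subfield ((\<lambda>r. evx r) ` mrats C V)" "is_subfield ((\<lambda>r. evx r) ` mrats C Vn)"
    by (rule is_subfield_evx; auto)+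
  show "(\<lambda>r. evx r) ` mrats C Vn \<subseteq> (\<lambda>r. evx r) ` mrats C V" using sub by blast
  note R = is_subfieldD[OF is_subfield_mrats[OF C, of V]]
  fix s assume "s \<in> transl ` H"
  then obtain g where s: "s = transl g" and g: "g \<in> carrier (affine_group n C)" using H by blast
  show "s 1 = 1" using transl_evx[OF R(2), of g] s by (simp add: mrat_eval_0_1)
  show "s (a + b) = s a + s b" "s (a * b) = s a * s b"
    if ab: "a \<in> (\<lambda>r. evx r) ` mrats C V" "b \<in> (\<lambda>r. evx r) ` mrats C V" for a b
  proof -
    obtain p q where pq: "a = evx p" "b = evx q" "p \<in> mrats C V" "q \<in> mrats C V" using ab by blast
    show "s (a + b) = s a + s b"
      using pq R(3) by (simp add: s transl_evx mrat_eval_add[OF generic_act[OF g]]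
          flip: mrat_eval_add[OF generic_x])
    show "s (a * b) = s a * s b"
      using pq R(5) by (simp add: s transl_evx mrat_eval_mult[OF generic_act[OF g]]
          flip: mrat_eval_mult[OF generic_x])
  qed
  show "s a \<in> (\<lambda>r. evx r) ` mrats C Vn" if a: "a \<in> (\<lambda>r. evx r) ` mrats C Vn" for a
  proof -
    obtain p q where pq: "a = evx (Fract p q)" "p \<in> mpolys C Vn" "q \<in> mpolys C Vn" "q \<noteq> 0"
      using a by (auto simp: mrats_def)
    have subp: "mpolys C Vn \<subseteq> mpolys C V" by (rule mpolys_mono) auto
    have pqV: "p \<in> mpolys C V" "q \<in> mpolys C V" using pq subp by auto
    have "Fract p q \<in> mrats C V" using pqV pq(4) by (auto simp: mrats_def)
    then have "s a = ev (act g x) p / ev (act g x) q"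
      using pqV pq(4) by (simp add: s pq(1) transl_evx mrat_eval_quotient[OF generic_act[OF g]])
    also have "\<dots> = ev x (affine_subst n g p) / ev x (affine_subst n g q)"
      using pqV by (simp add: ev_affine_subst[OF g x])
    also have "\<dots> = evx (Fract (affine_subst n g p) (affine_subst n g q))"
      using affine_subst_mem[OF C g pqV(2)] affine_subst_eq_0[OF g pqV(2)] pq(4)
      by (subst mrat_eval_quotient[OF generic_x]) auto
    also have "\<dots> \<in> (\<lambda>r. evx r) ` mrats C Vn"
      using affine_subst_mem[OF C g pq(2)] affine_subst_mem[OF C g pq(3)]
        affine_subst_eq_0[OF g pqV(2)] pq(4) unfolding mrats_def by blast
    finally show ?thesis .
  qed
qed

lemma inv_diff_field_iff:
  "e \<in> inv_diff_field d C n x H \<longleftrightarrow>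
    (\<exists>r \<in> mrats C V. e = evx r \<and> (\<forall>g\<in>H. diff_rat_eval d r (act g x) = evx r))"
  unfolding inv_diff_field_def act_def by (fastforce split: prod.splits)

lemma inv_diff_field_eq_fixed:
  assumes H: "H \<subseteq> carrier (affine_group n C)"
  shows "inv_diff_field d C n x H = field_homs.fixed (transl ` H) ((\<lambda>r. evx r) ` mrats C V)"
  unfolding field_homs.fixed_def[OF field_homs_transl[OF H]]
  by (auto simp: inv_diff_field_iff transl_evx)

section \<open>The differential field of invariants contains the constants and the Wronskian
  quotients\<close>

lemma is_diff_subfield_inv_diff_field:
  assumes H: "H \<subseteq> carrier (affine_group n C)"
  shows "is_diff_subfield d (inv_diff_field d C n x H)"
  unfolding is_diff_subfield_def
proof (intro conjI ballI)
  show "is_subfield (inv_diff_field d C n x H)"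
    unfolding inv_diff_field_eq_fixed[OF H]
    by (rule field_homs.is_subfield_fixed[OF field_homs_transl[OF H]])
  fix e assume "e \<in> inv_diff_field d C n x H"
  then obtain r where r: "r \<in> mrats C V" "e = evx r"
    "\<And>g. g \<in> H \<Longrightarrow> diff_rat_eval d r (act g x) = evx r"
    unfolding inv_diff_field_iff by blast
  \<comment> \<open>\<open>r'\<close> represents the derivative at x and at every hx + h0 at once,
    so the invariance of \<open>r\<close> passes to it.\<close>
  obtain r' where r': "r' \<in> mrats C V"
    "\<And>y. generic_point C V (jet d y) \<Longrightarrow> diff_rat_eval d r' y = d (diff_rat_eval d r y)"
    using mrat_derivative[OF r(1)] by blast
  then have "diff_rat_eval d r' (act g x) = evx r'" if "g \<in> H" for g
    using r(3)[OF that] generic_x generic_act that H by (metis subsetD)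
  with r r' generic_x show "d e \<in> inv_diff_field d C n x H"
    unfolding inv_diff_field_iff by metis
qed

lemma const_mem_inv_diff_field:
  assumes "c \<in> C"
  shows "c \<in> inv_diff_field d C n x H"
proof -
  have "diff_rat_eval d (rconst c) y = c" for y
    by (simp add: rconst_def mrat_eval_Fract[OF comm_ring_hom_ident] ev_one
        mpoly_eval_const[OF comm_ring_hom_ident])
  with evx_const(1)[OF assms] show ?thesis unfolding inv_diff_field_iff by metis
qed

lemma wronskian_quotient_mem_inv_diff_field:
  assumes H: "H \<subseteq> carrier (affine_group n C)" and i: "i \<in> {1..n}"
  shows "wronskian_del d n i x / wronskian d n x \<in> inv_diff_field d C n x H"
proof -
  define ms where "ms = filter (\<lambda>m. m \<noteq> i) [1..<n+2]"
  have ms: "0 \<notin> set ms" "length ms = n" using i by (auto simp: ms_def filter_upt_neq simp del: upt_Suc)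
  have ns: "0 \<notin> set [1..<n+1]" "length [1..<n+1] = n" by auto
  define r where "r = Fract (jet_det_poly ms) (jet_det_poly [1..<n+1])"
  have r: "r \<in> mrats C V"
    using jet_det_poly_mem wronskian_poly_nonzero unfolding r_def mrats_def by blast
  have e: "diff_rat_eval d r y = jet_det d n ms y / jet_det d n [1..<n+1] y"
    if "generic_point C V (jet d y)" "y \<in> carrier_vec n" for y
    unfolding r_def mrat_eval_quotient[OF that(1) jet_det_poly_mem wronskian_poly_nonzero]
    by (simp only: ev_jet_det_poly[OF that(2)] ms ns)
  have "diff_rat_eval d r (act g x) = evx r" if "g \<in> H" for g
  proof -
    obtain h h0 where gh: "g = (h, h0)" by fastforce
    have g: "g \<in> carrier (affine_group n C)" using that H by blast
    then have "det h \<noteq> 0" by (simp add: gh affine_group_def)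
    then show ?thesis
      using jet_det_act[OF g[unfolded gh] x ms] jet_det_act[OF g[unfolded gh] x ns]
      unfolding e[OF generic_x x] e[OF generic_act[OF g] act_mem[OF g x]] by (simp add: gh del: upt_Suc)
  qed
  moreover have "evx r = wronskian_del d n i x / wronskian d n x"
    by (simp only: e[OF generic_x x] wronskian_eq_jet_det wronskian_del_eq_jet_det ms_def)
  ultimately show ?thesis using r unfolding inv_diff_field_iff by metis
qed

section \<open>Every invariant is generated\<close>

lemma inv_mrats_iff:
  assumes H: "H \<subseteq> carrier (affine_group n C)"
  shows "r \<in> inv_mrats n C H \<longleftrightarrow> r \<in> mrats C Vn \<and> (\<forall>g\<in>H. diff_rat_eval d r (act g x) = evx r)"
proof -
  have "mrats C Vn \<subseteq> mrats C V" by (rule mrats_mono) auto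
  then show ?thesis unfolding inv_mrats_def using H by (auto simp: invariant_iff subset_iff)
qed

text \<open>The rational functions whose value at \<open>x\<close> lies in \<open>L\<close> form a
  subfield \<open>T\<close>. It contains the generators, hence by minimality of the hull all formal
  invariants, and an element of M fixed by the action is the value of one of these.\<close>

lemma fixed_low_order_mem:
  assumes H: "H \<subseteq> carrier (affine_group n C)"
    and gen: "is_subfield hull (rconst ` C \<union> \<Phi>) = inv_mrats n C H"
    and L: "is_subfield L" "C \<subseteq> L" "(\<lambda>r. evx r) ` \<Phi> \<subseteq> L"
  shows "field_homs.fixed (transl ` H) ((\<lambda>r. evx r) ` mrats C Vn) \<subseteq> L"
proof
  have sub: "mrats C Vn \<subseteq> mrats C V" by (rule mrats_mono) auto
  fix e assume "e \<in> field_homs.fixed (transl ` H) ((\<lambda>r. evx r) ` mrats C Vn)"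
  then obtain r where r: "r \<in> mrats C Vn" "e = evx r" "\<forall>g\<in>H. transl g (evx r) = evx r"
    unfolding field_homs.fixed_def[OF field_homs_transl[OF H]] by blast
  then have "\<forall>g\<in>H. diff_rat_eval d r (act g x) = evx r"
    using transl_evx[OF subsetD[OF sub r(1)]] by simp
  with r have mem: "r \<in> is_subfield hull (rconst ` C \<union> \<Phi>)" unfolding gen inv_mrats_iff[OF H] by blast
  define T where "T = {r \<in> mrats C V. evx r \<in> L}"
  note R = is_subfieldD[OF is_subfield_mrats[OF C, of V]] and L' = is_subfieldD[OF L(1)]
  have "is_subfield T"
    unfolding is_subfield_def
  proof (intro conjI ballI)
    show "0 \<in> T" "1 \<in> T" using R(1,2) L'(1,2) by (auto simp: T_def mrat_eval_0_1)
  next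
    fix r s assume "r \<in> T" "s \<in> T"
    then have rs: "r \<in> mrats C V" "s \<in> mrats C V" "evx r \<in> L" "evx s \<in> L" by (auto simp: T_def)
    show "r + s \<in> T" "r - s \<in> T" "r * s \<in> T"
      using R(3-5)[OF rs(1,2)] L'(3-5)[OF rs(3,4)] mrat_eval_hom[OF generic_x rs(1,2)]
      by (simp_all add: T_def)
  next
    fix r assume "r \<in> T"
    then show "inverse r \<in> T"
      using R(6)[of r] L'(6)[of "evx r"] mrat_eval_inverse[OF generic_x, of r] by (simp add: T_def)
  qed
  moreover have "\<Phi> \<subseteq> mrats C V"
    using hull_subset[of "rconst ` C \<union> \<Phi>" is_subfield] sub unfolding gen inv_mrats_def by blast
  then have "rconst ` C \<union> \<Phi> \<subseteq> T"
    using L evx_const by (auto simp: T_def)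
  ultimately have "is_subfield hull (rconst ` C \<union> \<Phi>) \<subseteq> T" by (intro hull_minimal)
  with mem show "e \<in> L" using r(2) by (auto simp: T_def)
qed

text \<open>The span is closed under sums and products, so only constants and single derivatives
  need to be checked; the latter are reduced to orders up to \<open>n\<close> by
  \<open>d_iterate_mem_lspan\<close>.\<close>

lemma ev_mem_lspan:
  assumes L: "is_diff_subfield d L" "C \<subseteq> L"
    and W: "\<And>i. i \<in> {1..n} \<Longrightarrow> wronskian_del d n i x / wronskian d n x \<in> L"
    and p: "p \<in> mpolys C V"
  shows "ev x p \<in> lspan L ((\<lambda>r. evx r) ` mrats C Vn)" (is "_ \<in> lspan L ?M")
proof -
  have Lf: "is_subfield L" using L by (simp add: is_diff_subfield_def)
  have Mf: "is_subfield ?M" by (rule is_subfield_evx) auto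
  from p show ?thesis
  proof (induction rule: mpolys_induct)
    case (const c)
    \<comment> \<open>A constant is a scalar times 1, and 1 lies in M; the extra constants 0 and 1
      of the induction rule lie in \<open>L\<close>.\<close>
    then have "c * 1 \<in> lspan L ?M"
      using L is_subfieldD(1,2)[OF Lf] by (intro lspan.scale is_subfieldD[OF Mf]) auto
    then show ?case by (simp add: mpoly_eval_const[OF comm_ring_hom_ident])
  next
    case (var v)
    then obtain j m where v: "v = (j, m)" "j < n" by auto
    have "(\<lambda>i. (d ^^ i) (x $ j)) ` {..n} \<subseteq> ?M"
    proof (clarify)
      fix i assume "i \<le> n"
      have "mpoly_var (j, i) \<in> mpolys C Vn"
        using v \<open>i \<le> n\<close> by (intro mpolys_single is_subfieldD[OF C]) auto
      then have "Fract (mpoly_var (j, i)) 1 \<in> mrats C Vn"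
        using mpolys_one is_subfieldD(1,2)[OF C] unfolding mrats_def by fastforce
      moreover have "evx (Fract (mpoly_var (j, i)) 1) = (d ^^ i) (x $ j)"
        by (simp add: mrat_eval_Fract[OF comm_ring_hom_ident] ev_one
            mpoly_eval_var[OF comm_ring_hom_ident, simplified]) (simp add: jet_def)
      ultimately show "(d ^^ i) (x $ j) \<in> ?M" by (metis imageI)
    qed
    with d_iterate_mem_lspan[OF L(1) W v(2)] have "(d ^^ m) (x $ j) \<in> lspan L ?M"
      by (rule lspan_mono)
    moreover have "ev x (mpoly_var (j, m)) = (d ^^ m) (x $ j)"
      unfolding mpoly_eval_var[OF comm_ring_hom_ident] by (simp add: jet_def)
    ultimately show ?case unfolding v by simp
  next
    case (add p q)
    then show ?case by (simp add: mpoly_eval_add[OF comm_ring_hom_ident] lspan.add)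
  next
    case (mult p q)
    then show ?case
      using lspan_mult[OF is_subfieldD(5)[OF Lf] is_subfieldD(5)[OF Mf]]
      by (simp add: mpoly_eval_mult[OF comm_ring_hom_ident])
  qed
qed

text \<open>Numerator and denominator of an invariant lie in the \<open>L\<close>-span of M, so
  \<open>fixed_quotient_mem\<close> applies. It requires the elements of \<open>L\<close> to be
  invariant, whence the inclusion among the premises.\<close>

lemma inv_diff_field_subset:
  assumes H: "H \<subseteq> carrier (affine_group n C)"
    and gen: "is_subfield hull (rconst ` C \<union> \<Phi>) = inv_mrats n C H"
    and L: "is_diff_subfield d L" "L \<subseteq> inv_diff_field d C n x H" "C \<subseteq> L" "(\<lambda>r. evx r) ` \<Phi> \<subseteq> L"
    and W: "\<And>i. i \<in> {1..n} \<Longrightarrow> wronskian_del d n i x / wronskian d n x \<in> L"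
  shows "inv_diff_field d C n x H \<subseteq> L"
proof
  fix f assume f: "f \<in> inv_diff_field d C n x H"
  then obtain r where "r \<in> mrats C V" "f = evx r" unfolding inv_diff_field_iff by blast
  then obtain p q where pq: "p \<in> mpolys C V" "q \<in> mpolys C V" "ev x q \<noteq> 0" "f = ev x p / ev x q"
    using mratsE[OF _ generic_x] generic_x by metis
  have Lf: "is_subfield L" using L by (simp add: is_diff_subfield_def)
  show "f \<in> L" unfolding pq(4)
  proof (rule field_homs.fixed_quotient_mem[OF field_homs_transl[OF H] Lf])
    show "L \<subseteq> field_homs.fixed (transl ` H) ((\<lambda>r. evx r) ` mrats C V)"
      using L(2) unfolding inv_diff_field_eq_fixed[OF H] .
    show "field_homs.fixed (transl ` H) ((\<lambda>r. evx r) ` mrats C Vn) \<subseteq> L"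
      by (rule fixed_low_order_mem[OF H gen Lf L(3,4)])
    show "ev x p / ev x q \<in> field_homs.fixed (transl ` H) ((\<lambda>r. evx r) ` mrats C V)"
      using f unfolding pq(4) inv_diff_field_eq_fixed[OF H] .
  qed (use pq ev_mem_lspan[OF L(1,3) W] in auto)
qed

end

text \<open>Differential subfields are closed under intersection, so the hull is one itself and can
  serve as \<open>L\<close>.\<close>

lemma is_diff_subfield_hull: "is_diff_subfield d (is_diff_subfield d hull S)"
  unfolding hull_def by (auto simp: is_diff_subfield_def is_subfield_def)

theorem mainTheorem4:
  fixes d :: "'k::field_char_0 \<Rightarrow> 'k" and F C :: "'k set"
    and n k :: nat and x :: "'k vec" and H :: "('k mat \<times> 'k vec) set"
    and \<phi> :: "nat \<Rightarrow> 'k mrat"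
  assumes "derivation d"
    and "is_diff_subfield d F"
    and "C = const_field d F"
    and "C \<noteq> F"
    and "n > 1"
    and "x \<in> carrier_vec n"
    and "diff_alg_indep d F n x"
    and "subgroup H (affine_group n C)"
    and "is_subfield hull (rconst ` C \<union> \<phi> ` {1..k}) = inv_mrats n C H"
  shows "is_diff_subfield d hull
           (C \<union> {wronskian_del d n i x / wronskian d n x | i. i \<in> {1..n}}
              \<union> {mrat_eval (\<lambda>c. c) (\<lambda>(j, m). (d ^^ m) (x $ j)) (\<phi> i) | i. i \<in> {1..k}})
         = inv_diff_field d C n x H"
    (is "is_diff_subfield d hull ?S = _")
proof -
  \<comment> \<open>\<open>C\<close> lies in \<open>F\<close>, so independence over \<open>F\<close>
    yields genericity over \<open>C\<close>.\<close>
  have "mpolys C ({..<n} \<times> UNIV) \<subseteq> mpolys F ({..<n} \<times> UNIV)"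
    unfolding assms(3) by (rule mpolys_mono) (auto simp: const_field_def)
  then have "generic_point C ({..<n} \<times> UNIV) (jet d x)"
    using assms(7) by (auto simp: generic_point_def diff_alg_indep_def)
  then interpret diff_indep d C n x
    using assms(1,6) is_subfield_const_field[OF assms(1,2)]
    by unfold_locales (auto simp: assms(3) const_field_def)
  have H: "H \<subseteq> carrier (affine_group n C)" using assms(8) by (rule subgroup.subset)
  have S: "?S = C \<union> {wronskian_del d n i x / wronskian d n x | i. i \<in> {1..n}} \<union>
      (\<lambda>r. evx r) ` (\<phi> ` {1..k})"
    by (auto simp: jet_def)
  have sub: "mrats C Vn \<subseteq> mrats C V" by (rule mrats_mono) auto
  have "\<phi> ` {1..k} \<subseteq> inv_mrats n C H"
    using hull_subset[of "rconst ` C \<union> \<phi> ` {1..k}" is_subfield] unfolding assms(9) by blast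
  then have "(\<lambda>r. evx r) ` (\<phi> ` {1..k}) \<subseteq> inv_diff_field d C n x H"
    using sub unfolding inv_mrats_iff[OF H] inv_diff_field_iff subset_iff by blast
  then have "?S \<subseteq> inv_diff_field d C n x H"
    unfolding S using const_mem_inv_diff_field wronskian_quotient_mem_inv_diff_field[OF H] by blast
  \<comment> \<open>Besides being half of the claim, this inclusion is a premise of the converse:
    the coefficients taken from the hull must be invariant.\<close>
  then have 1: "is_diff_subfield d hull ?S \<subseteq> inv_diff_field d C n x H"
    by (intro hull_minimal is_diff_subfield_inv_diff_field H)
  have 2: "?S \<subseteq> is_diff_subfield d hull ?S" by (rule hull_subset)
  have "inv_diff_field d C n x H \<subseteq> is_diff_subfield d hull ?S"
  proof (rule inv_diff_field_subset[OF H assms(9) is_diff_subfield_hull 1])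
    show "C \<subseteq> is_diff_subfield d hull ?S" using 2 by blast
    show "(\<lambda>r. evx r) ` (\<phi> ` {1..k}) \<subseteq> is_diff_subfield d hull ?S" using 2 unfolding S by blast
    show "wronskian_del d n i x / wronskian d n x \<in> is_diff_subfield d hull ?S" if "i \<in> {1..n}" for i
      using 2 that by blast
  qed
  with 1 show ?thesis by (rule subset_antisym)
qed

end
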